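(* Let $r\ge 1$ be an integer and let $G=(V,E)$ be a finite simple undirected graph. If $\mathrm{rankwidth}(G)\ge 72r$, then $G$ contains an induced subgraph $H$ with $\operatorname{min\text{-}bal\text{-}cutrank}(H)\ge r$.
   Context: For a graph $G$ and disjoint vertex sets $X,Y\subseteq V(G)$, $\operatorname{Adj}_G(X,Y)$ is the $|X|\times|Y|$ $0/1$ matrix whose $(x,y)$ entry is $1$ iff $xy\in E(G)$. For a partition $(X,Y)$ of $V(G)$ (i.e. $X\cup Y=V(G)$, $X\cap Y=\emptyset$), $\operatorname{cutrank}_G(X,Y)$ is the rank over $\mathbb{F}_2$ of $\operatorname{Adj}_G(X,Y)$. For a graph $G$ on $n$ vertices, $\operatorname{min\text{-}bal\text{-}cutrank}(G)=\min\{\operatorname{cutrank}_G(X,Y) : X\sqcup Y=V(G),\ |X|,|Y|\le 2n/3\}$ (equivalently over partitions with $|X|,|Y|\ge n/3$). A rank-decomposition of $G$ is a pair $(T,\gamma)$ where $T$ is a tree all of whose vertices have degree at most $3$ and $\gamma$ is a bijection from $V(G)$ to the leaves of $T$; deleting an edge $e$ of $T$ splits the leaves into two parts, inducing a partition $(X_e,Y_e)$ of $V(G)$. The rankwidth of $G$ is $\min_{(T,\gamma)}\max_{e\in E(T)}\operatorname{cutrank}_G(X_e,Y_e)$. *)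

theory Defs
  imports
    Complex_Main
    "HOL-Library.Z2"
    "HOL-Library.Function_Algebras"
    "Graph_Theory.Digraph_Component"
begin

text \<open>
  Finite simple undirected graphs are those satisfying \<^locale>\<open>pair_graph\<close>: an edge \<open>xy\<close> is
  represented by the two arcs \<open>(x, y)\<close> and \<open>(y, x)\<close>.
\<close>

definition Adj :: "'a pair_pre_digraph \<Rightarrow> 'a \<Rightarrow> 'a \<Rightarrow> bit" where
  "Adj G x y = (if (x, y) \<in> parcs G then 1 else 0)"

text \<open>
  The matrix rank of HOL-Analysis (dimension of the span of the rows) is only
  available for matrices indexed by finite types.  The same notion for the submatrix with rows
  \<open>X\<close> and columns \<open>Y\<close> uses rows that are functions vanishing outside \<open>Y\<close>.
\<close>

abbreviation F2_scale :: "bit \<Rightarrow> ('b \<Rightarrow> bit) \<Rightarrow> 'b \<Rightarrow> bit" where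
  "F2_scale c v \<equiv> (\<lambda>y. c * v y)"

lemma vector_space_F2_scale: "vector_space (F2_scale :: bit \<Rightarrow> ('b \<Rightarrow> bit) \<Rightarrow> 'b \<Rightarrow> bit)"
  by unfold_locales (auto simp: fun_eq_iff algebra_simps)

definition F2_rank :: "'a set \<Rightarrow> 'b set \<Rightarrow> ('a \<Rightarrow> 'b \<Rightarrow> bit) \<Rightarrow> nat" where
  "F2_rank X Y M =
     vector_space.dim F2_scale ((\<lambda>x. (\<lambda>y. if y \<in> Y then M x y else 0)) ` X)"

definition cutrank :: "'a pair_pre_digraph \<Rightarrow> 'a set \<Rightarrow> 'a set \<Rightarrow> nat" where
  "cutrank G X Y = F2_rank X Y (Adj G)"

text \<open>
  A balanced partition exists unless \<open>G\<close> has exactly one vertex; in that case the minimum is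
  \<open>0\<close> by convention.
\<close>

definition balanced_partitions :: "'a pair_pre_digraph \<Rightarrow> ('a set \<times> 'a set) set" where
  "balanced_partitions G =
     {(X, Y). X \<union> Y = pverts G \<and> X \<inter> Y = {} \<and>
        real (card X) \<le> 2 * real (card (pverts G)) / 3 \<and>
        real (card Y) \<le> 2 * real (card (pverts G)) / 3}"

definition min_bal_cutrank :: "'a pair_pre_digraph \<Rightarrow> nat" where
  "min_bal_cutrank G =
     (if balanced_partitions G = {} then 0
      else (INF (X, Y) \<in> balanced_partitions G. cutrank G X Y))"

text \<open>
  The library's \<^const>\<open>tree\<close> is unsuitable here: with arcs in both directions, every edge yields a
  \<^const>\<open>pre_digraph.cycle\<close> of length 2.  From length 3 on, cycles are those of the undirected graph.
\<close>

definition undirected_tree :: "'a pair_pre_digraph \<Rightarrow> bool" where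
  "undirected_tree T \<longleftrightarrow>
     pair_graph T \<and> Digraph_Component.connected T \<and>
     (\<nexists>p. pre_digraph.cycle T p \<and> 3 \<le> length p)"

text \<open>
  In a \<^locale>\<open>pair_graph\<close>, \<^const>\<open>out_degree\<close> is the degree.  Degree 0 is admitted so that the vertex of
  a one-vertex tree counts as a leaf, which gives one-vertex graphs a rank-decomposition.
\<close>

definition leaves :: "'a pair_pre_digraph \<Rightarrow> 'a set" where
  "leaves T = {t \<in> pverts T. out_degree T t \<le> 1}"

definition rank_decomposition ::
    "'a pair_pre_digraph \<Rightarrow> 'b pair_pre_digraph \<Rightarrow> ('a \<Rightarrow> 'b) \<Rightarrow> bool" where
  "rank_decomposition G T \<gamma> \<longleftrightarrow>
     undirected_tree T \<and> (\<forall>t \<in> pverts T. out_degree T t \<le> 3) \<and>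
     bij_betw \<gamma> (pverts G) (leaves T)"

definition delete_edge :: "'a pair_pre_digraph \<Rightarrow> 'a \<Rightarrow> 'a \<Rightarrow> 'a pair_pre_digraph" where
  "delete_edge T a b = T\<lparr>parcs := parcs T - {(a, b), (b, a)}\<rparr>"

text \<open>The vertices of \<open>G\<close> placed at leaves on the side of \<open>a\<close> after deleting the edge \<open>ab\<close> of \<open>T\<close>.\<close>

definition edge_side ::
    "'a pair_pre_digraph \<Rightarrow> 'b pair_pre_digraph \<Rightarrow> ('a \<Rightarrow> 'b) \<Rightarrow> 'b \<Rightarrow> 'b \<Rightarrow> 'a set" where
  "edge_side G T \<gamma> a b = {v \<in> pverts G. a \<rightarrow>\<^sup>*\<^bsub>delete_edge T a b\<^esub> \<gamma> v}"

text \<open>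
  Every edge occurs in both orientations, which is harmless since the cut-rank is symmetric.
  The supremum of the empty set of natural numbers is 0, the width of the one-vertex tree.
\<close>

definition decomposition_width ::
    "'a pair_pre_digraph \<Rightarrow> 'b pair_pre_digraph \<Rightarrow> ('a \<Rightarrow> 'b) \<Rightarrow> nat" where
  "decomposition_width G T \<gamma> =
     (SUP (a, b) \<in> parcs T. cutrank G (edge_side G T \<gamma> a b) (edge_side G T \<gamma> b a))"

text \<open>
  Trees are finite, so taking their vertices to be natural numbers is no restriction.
  Only the graph without vertices has no rank-decomposition; its rankwidth is \<open>0\<close> by convention.
\<close>

definition rankwidth :: "'a pair_pre_digraph \<Rightarrow> nat" where
  "rankwidth G =
     (if pverts G = {} then 0
      else (INF (T, \<gamma>) \<in> {(T :: nat pair_pre_digraph, \<gamma>). rank_decomposition G T \<gamma>}.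
              decomposition_width G T \<gamma>))"

end

theory Submission
  imports Defs
begin

text \<open>
  Write \<open>\<rho>(Z)\<close> for the cut-rank of \<open>(Z, V - Z)\<close>.  If every set \<open>S\<close> with \<open>\<rho>(S) \<le> 72r - 1\<close> could be
  split into two nonempty parts of the same kind, repeated splitting would give a rank-decomposition
  of width less than \<open>72r\<close>.  So some \<open>S\<close> cannot be split, and a basis \<open>W\<close> of the columns outside
  \<open>S\<close> is well-linked: \<open>\<rho>(Z) \<ge> min |W \<inter> Z| |W - Z|\<close> for all \<open>Z\<close>.  Call \<open>Z\<close> big if it contains at
  least \<open>24r\<close> elements of \<open>W\<close>.

  Suppose that every induced subgraph has a balanced cut of rank less than \<open>r\<close>.  Cutting a smallest
  big set with \<open>\<rho> \<le> k\<close> shows that the smallest size drops by a factor of \<open>2/3\<close> when \<open>k\<close> grows by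
  \<open>r\<close>.  Hence if \<open>S\<close> is a smallest big set with \<open>\<rho>(S) \<le> 18r - 1\<close>, then \<open>\<rho>(Z) \<ge> 12r\<close> for all
  \<open>Z \<supseteq> S\<close> with \<open>|Z| \<le> 9|S|\<close>.  This allows attaching to \<open>S\<close>, greedily, disjoint sets of size \<open>12r\<close>,
  each of them freely linked to \<open>S\<close> inside the subgraph built so far, until their union \<open>A\<close> satisfies
  \<open>|A| \<ge> 8|S|\<close>.  A balanced cut of \<open>S \<union> A\<close> has at least a quarter of \<open>A\<close> on each side, so each side
  contains many independent columns of \<open>S\<close>, and the cut splits \<open>S\<close> into two parts with
  \<open>\<rho> \<le> 18r - 1\<close>.  One of them is big, which contradicts the minimality of \<open>S\<close>.
\<close>

section \<open>Submodular rank functions\<close>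

text \<open>Models the rank of the submatrix with rows \<open>X\<close> and columns \<open>Y\<close>
  of a symmetric matrix. For fixed \<open>X\<close> it behaves like the rank function of a matroid
  on the columns.\<close>

locale rank_bifunction =
  fixes R :: "'a set \<Rightarrow> 'a set \<Rightarrow> nat"
  assumes rank_sym: "R X Y = R Y X"
    and rank_empty: "R {} Y = 0"
    and rank_singleton_le: "R {x} Y \<le> 1"
    and rank_mono: "X \<subseteq> X' \<Longrightarrow> Y \<subseteq> Y' \<Longrightarrow> R X Y \<le> R X' Y'"
    and rank_submod: "R (X1 \<union> X2) (Y1 \<inter> Y2) + R (X1 \<inter> X2) (Y1 \<union> Y2) \<le> R X1 Y1 + R X2 Y2"
begin

lemma rank_Un_left_le: "R (X1 \<union> X2) Y \<le> R X1 Y + R X2 Y"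
  using rank_submod[of X1 X2 Y Y] by simp

lemma rank_Un_right_le: "R X (Y1 \<union> Y2) \<le> R X Y1 + R X Y2"
  using rank_Un_left_le rank_sym by metis

lemma rank_insert_right_le: "R X (insert y Y) \<le> R X Y + 1"
  using rank_Un_right_le[of X "{y}" Y] rank_singleton_le[of y X] rank_sym[of X "{y}"] by simp

lemma rank_le_card: "finite Y \<Longrightarrow> R X Y \<le> card Y"
proof (induction Y rule: finite_induct)
  case empty
  then show ?case using rank_empty rank_sym by (metis card.empty le_refl)
next
  case (insert y Y)
  then show ?case using rank_insert_right_le[of X y Y] by simp
qed

definition indep :: "'a set \<Rightarrow> 'a set \<Rightarrow> bool" where
  "indep X I \<longleftrightarrow> finite I \<and> R X I = card I"

lemma indep_subset:
  assumes "indep X I" "J \<subseteq> I"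
  shows "indep X J"
proof -
  have fin: "finite I" "finite J" using assms finite_subset unfolding indep_def by auto
  have "card I \<le> R X J + R X (I - J)"
    using rank_Un_right_le[of X J "I - J"] assms by (simp add: indep_def Un_absorb1)
  moreover have "R X (I - J) \<le> card I - card J"
    using rank_le_card[of "I - J" X] fin assms(2) by (simp add: card_Diff_subset)
  moreover have "card J \<le> card I" using fin assms(2) by (simp add: card_mono)
  ultimately have "card J \<le> R X J" by linarith
  then have "R X J = card J" using rank_le_card[OF fin(2), of X] by (rule order_antisym[rotated])
  then show ?thesis using fin by (simp add: indep_def)
qed

text \<open>By submodularity, a column that adds nothing to \<open>B\<close> adds nothing to larger
  sets, so \<open>F\<close> can be added one column at a time.\<close>

lemma rank_saturated:
  assumes "finite F" and "\<And>y. y \<in> F \<Longrightarrow> R X (insert y B) = R X B"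
  shows "R X (B \<union> F) = R X B"
  using assms
proof (induction F rule: finite_induct)
  case empty
  then show ?case by simp
next
  case (insert y F)
  have "R X ((B \<union> F) \<inter> insert y B) + R X ((B \<union> F) \<union> insert y B) \<le> R X (B \<union> F) + R X (insert y B)"
    using rank_submod[of X X "B \<union> F" "insert y B"] by simp
  moreover have "R X B \<le> R X ((B \<union> F) \<inter> insert y B)" by (rule rank_mono) auto
  moreover have "(B \<union> F) \<union> insert y B = insert y (B \<union> F)" by auto
  ultimately have "R X (insert y (B \<union> F)) \<le> R X B" using insert by simp
  moreover have "R X B \<le> R X (insert y (B \<union> F))" by (rule rank_mono) auto
  ultimately show ?case by simp
qed

text \<open>A largest independent set between \<open>I\<close> and \<open>F\<close> works: by
  maximality it is saturated in \<open>F\<close>.\<close>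

lemma indep_extend:
  assumes "indep X I" "I \<subseteq> F" "finite F"
  shows "\<exists>B. I \<subseteq> B \<and> B \<subseteq> F \<and> indep X B \<and> R X F = card B"
proof -
  define P where "P B \<longleftrightarrow> I \<subseteq> B \<and> B \<subseteq> F \<and> indep X B" for B
  have "\<forall>B. P B \<longrightarrow> card B < Suc (card F)"
    using assms(3) by (simp add: P_def card_mono less_Suc_eq_le)
  moreover have "P I" using assms by (simp add: P_def)
  ultimately have "\<exists>B. P B \<and> (\<forall>C. P C \<longrightarrow> card C \<le> card B)"
    by (intro ex_has_greatest_nat)
  then obtain B where B: "P B" and max: "\<And>C. P C \<Longrightarrow> card C \<le> card B" by blast
  have finB: "finite B" and RB: "R X B = card B" and BF: "B \<subseteq> F" using B by (auto simp: P_def indep_def)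
  have "R X (insert y B) = R X B" if "y \<in> F" for y
  proof (rule ccontr)
    assume ne: "R X (insert y B) \<noteq> R X B"
    then have "y \<notin> B" by (auto simp: insert_absorb)
    moreover have "R X (insert y B) = R X B + 1"
      using ne rank_insert_right_le[of X y B] rank_mono[OF subset_refl subset_insertI, of X B y] by linarith
    ultimately have "P (insert y B)"
      using B that finB RB by (auto simp: P_def indep_def)
    then show False using max[of "insert y B"] \<open>y \<notin> B\<close> finB by simp
  qed
  then have "R X (B \<union> F) = R X B" using rank_saturated[OF assms(3)] by blast
  then have "R X F = card B" using BF RB by (simp add: Un_absorb1)
  then show ?thesis using B by (auto simp: P_def)
qed

lemma indep_extend_card:
  assumes "indep X I" "I \<subseteq> F" "finite F" "card I \<le> m" "m \<le> R X F"
  shows "\<exists>B. I \<subseteq> B \<and> B \<subseteq> F \<and> indep X B \<and> card B = m"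
proof -
  obtain B where B: "I \<subseteq> B" "B \<subseteq> F" "indep X B" "R X F = card B"
    using indep_extend[OF assms(1-3)] by blast
  then have "finite B" by (simp add: indep_def)
  then obtain C where "I \<subseteq> C" "C \<subseteq> B" "card C = m"
    using exists_subset_between[of I m B] B(1,4) assms(4,5) by metis
  moreover have "indep X C" using indep_subset[OF B(3)] \<open>C \<subseteq> B\<close> .
  ultimately show ?thesis using B(2) by blast
qed

text \<open>The columns \<open>B\<close> span \<open>Y\<close> on the rows \<open>X\<close>, hence
  also on fewer rows; submodularity expresses this by ranks alone.\<close>

lemma basis_spans:
  assumes "B \<subseteq> Y" "R X B = R X Y" "X' \<subseteq> X"
  shows "R X' (Y \<union> C) \<le> R X' (B \<union> C)"
proof -
  have "R (X \<union> X') (Y \<inter> (B \<union> C)) + R (X \<inter> X') (Y \<union> (B \<union> C)) \<le> R X Y + R X' (B \<union> C)"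
    by (rule rank_submod)
  moreover have "R X B \<le> R (X \<union> X') (Y \<inter> (B \<union> C))" using assms by (intro rank_mono) auto
  moreover have "R X' (Y \<union> C) \<le> R (X \<inter> X') (Y \<union> (B \<union> C))" using assms by (intro rank_mono) auto
  ultimately show ?thesis using assms(2) by linarith
qed

end

section \<open>Cut-rank functions: well-linked sets, linked extensions and spread sets\<close>

locale rank_connectivity = rank_bifunction +
  fixes V :: "'a set"
  assumes finite_V: "finite V"
begin

definition cut :: "'a set \<Rightarrow> nat" where
  "cut Z = R Z (V - Z)"

lemma cut_compl: "Z \<subseteq> V \<Longrightarrow> cut (V - Z) = cut Z"
  by (simp add: cut_def rank_sym double_diff)

lemma cut_submod:
  "cut (Z1 \<union> Z2) + cut (Z1 \<inter> Z2) \<le> cut Z1 + cut Z2"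
  using rank_submod[of Z1 Z2 "V - Z1" "V - Z2"] by (simp add: cut_def Diff_Un Diff_Int)

lemma cut_remove_le:
  assumes "S \<subseteq> V" "v \<in> S"
  shows "cut (S - {v}) \<le> cut S + 1"
proof -
  have "V - (S - {v}) = insert v (V - S)" using assms by auto
  then show ?thesis
    using rank_insert_right_le[of "S - {v}" v "V - S"] rank_mono[of "S - {v}" S "V - S" "V - S"]
    by (simp add: cut_def)
qed

definition splits :: "nat \<Rightarrow> 'a set \<Rightarrow> bool" where
  "splits K S \<longleftrightarrow> (\<exists>S1 S2. S1 \<union> S2 = S \<and> S1 \<inter> S2 = {} \<and> S1 \<noteq> {} \<and> S2 \<noteq> {} \<and> cut S1 \<le> K \<and> cut S2 \<le> K)"

definition well_linked :: "'a set \<Rightarrow> bool" where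
  "well_linked W \<longleftrightarrow> W \<subseteq> V \<and> (\<forall>Z\<subseteq>V. min (card (W \<inter> Z)) (card (W - Z)) \<le> cut Z)"

text \<open>A basis of the columns outside an unsplittable set is well-linked, by submodularity.\<close>

lemma well_linked_if_not_splits:
  assumes S: "S \<subseteq> V" "2 \<le> card S" "cut S \<le> K" "\<not> splits K S" and "1 \<le> K"
  shows "\<exists>W. well_linked W \<and> card W = K"
proof -
  obtain v where v: "v \<in> S" using S(2) by fastforce
  have "\<not> S \<subseteq> {v}" using S(2) card_mono[of "{v}" S] by auto
  then have ne: "S - {v} \<noteq> {}" by blast
  have cutv: "cut {v} \<le> K"
    using rank_singleton_le[of v "V - {v}"] \<open>1 \<le> K\<close> by (simp add: cut_def)
  have "K < cut (S - {v})"
  proof (rule ccontr)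
    assume "\<not> K < cut (S - {v})"
    then have "splits K S" unfolding splits_def
      using ne cutv v by (intro exI[of _ "{v}"] exI[of _ "S - {v}"]) auto
    then show False using S(4) by simp
  qed
  \<comment> \<open>Removing \<open>v\<close> pushes the cut-rank above \<open>K\<close> but raises
    it by at most 1.\<close>
  then have cutS: "cut S = K" using cut_remove_le[OF S(1) v] S(3) by linarith
  have "indep S {}" using rank_le_card[of "{}" S] by (simp add: indep_def)
  then obtain W where W: "W \<subseteq> V - S" "indep S W" "R S (V - S) = card W"
    using indep_extend[of S "{}" "V - S"] finite_V by (metis empty_subsetI finite_Diff)
  have "min (card (W \<inter> Z)) (card (W - Z)) \<le> cut Z" if Z: "Z \<subseteq> V" for Z
  proof (rule ccontr)
    assume "\<not> ?thesis"
    then have small: "cut Z < card (W \<inter> Z)" "cut Z < card (W - Z)" by auto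
    \<comment> \<open>The independent columns \<open>W - Z'\<close> make the cut-rank of
      \<open>S \<union> Z'\<close> exceed that of \<open>Z'\<close>; submodularity then pushes that
      of \<open>S \<inter> Z'\<close> below \<open>cut S\<close>.\<close>
    have part: "cut (S \<inter> Z') < K" if "cut Z' < card (W - Z')" for Z'
    proof -
      have "card (W - Z') = R S (W - Z')"
        using indep_subset[OF W(2), of "W - Z'"] by (auto simp: indep_def)
      also have "\<dots> \<le> cut (S \<union> Z')"
        unfolding cut_def using W(1) by (intro rank_mono) auto
      finally show ?thesis using cut_submod[of S Z'] cutS that by linarith
    qed
    have 1: "cut (S \<inter> Z) < K" using part small by simp
    have "W - (V - Z) = W \<inter> Z" using W by auto
    then have "cut (S \<inter> (V - Z)) < K" using part[of "V - Z"] small cut_compl[OF Z] by simp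
    moreover have "S \<inter> (V - Z) = S - Z" using S by auto
    ultimately have 2: "cut (S - Z) < K" by simp
    show False
    proof (cases "S \<inter> Z = {} \<or> S - Z = {}")
      case True
      then have "S - Z = S \<or> S \<inter> Z = S" by auto
      then show False using 1 2 cutS by auto
    next
      case False
      then have "splits K S" unfolding splits_def using 1 2
        by (intro exI[of _ "S \<inter> Z"] exI[of _ "S - Z"]) auto
      then show False using S(4) by simp
    qed
  qed
  moreover have "W \<subseteq> V" using W by auto
  moreover have "card W = K" using W(3) cutS by (simp add: cut_def)
  ultimately show ?thesis unfolding well_linked_def by blast
qed

text \<open>
  \<open>C\<close> is chosen minimal with the required property.  By submodularity the sets \<open>Z\<close> attaining
  equality are closed under union, so a single \<open>Z\<close> witnesses that no element of \<open>C\<close> is redundant;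
  hence \<open>C\<close> is independent over that \<open>Z\<close>.
\<close>

lemma exists_linked_extension:
  assumes "S \<subseteq> H" "H \<subseteq> V" and conn: "\<And>Z. S \<subseteq> Z \<Longrightarrow> Z \<subseteq> H \<Longrightarrow> q \<le> cut Z"
  shows "\<exists>C \<subseteq> V - H. card C = q \<and> (\<forall>Z. S \<subseteq> Z \<longrightarrow> Z \<subseteq> H \<longrightarrow> q \<le> R Z ((H - Z) \<union> C))"
proof -
  define linked where "linked C \<longleftrightarrow> C \<subseteq> V - H \<and> (\<forall>Z. S \<subseteq> Z \<longrightarrow> Z \<subseteq> H \<longrightarrow> q \<le> R Z ((H - Z) \<union> C))" for C
  have "linked (V - H)"
  proof -
    have "(H - Z) \<union> (V - H) = V - Z" if "Z \<subseteq> H" for Z using that assms(2) by auto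
    then show ?thesis using conn by (auto simp: linked_def cut_def)
  qed
  then obtain C where C: "linked C" and min: "\<And>D. linked D \<Longrightarrow> card C \<le> card D"
    using ex_has_least_nat[of linked "V - H" card] by metis
  have CV: "C \<subseteq> V - H" and ge: "\<And>Z. S \<subseteq> Z \<Longrightarrow> Z \<subseteq> H \<Longrightarrow> q \<le> R Z ((H - Z) \<union> C)"
    using C by (auto simp: linked_def)
  have finC: "finite C" using CV finite_V finite_subset by blast
  define critical where "critical Z D \<longleftrightarrow> S \<subseteq> Z \<and> Z \<subseteq> H \<and> R Z ((H - Z) \<union> C) = q \<and>
      (\<forall>c\<in>D. R Z ((H - Z) \<union> (C - {c})) < q)" for Z D
  have critical_single: "\<exists>Z. critical Z {c}" if c: "c \<in> C" for c
  proof -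
    have "card (C - {c}) < card C" using c finC by (rule card_Diff1_less[rotated])
    then have "\<not> linked (C - {c})" using min[of "C - {c}"] by auto
    then obtain Z where Z: "S \<subseteq> Z" "Z \<subseteq> H" "R Z ((H - Z) \<union> (C - {c})) < q"
      using CV by (auto simp: linked_def not_le)
    \<comment> \<open>One column changes the rank by at most 1, so a bound that fails without
      \<open>c\<close> was tight with it.\<close>
    have "(H - Z) \<union> C = insert c ((H - Z) \<union> (C - {c}))" using c by auto
    then have "R Z ((H - Z) \<union> C) \<le> q"
      using rank_insert_right_le[of Z c "(H - Z) \<union> (C - {c})"] Z(3) by simp
    then have "critical Z {c}" using ge Z by (auto simp: critical_def intro: order_antisym)
    then show ?thesis by blast
  qed
  \<comment> \<open>The gain from column \<open>c\<close> does not shrink when rows are added and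
    other columns are removed.\<close>
  have critical_mono: "R Z' ((H - Z') \<union> (C - {c})) < q"
    if "Z \<subseteq> Z'" "R Z' ((H - Z') \<union> C) = q" "R Z ((H - Z) \<union> C) = q" "R Z ((H - Z) \<union> (C - {c})) < q" for Z Z' c
  proof -
    have "R (Z \<union> Z') (((H - Z) \<union> (C - {c})) \<inter> ((H - Z') \<union> C)) +
        R (Z \<inter> Z') (((H - Z) \<union> (C - {c})) \<union> ((H - Z') \<union> C))
        \<le> R Z ((H - Z) \<union> (C - {c})) + R Z' ((H - Z') \<union> C)"
      by (rule rank_submod)
    moreover have "R Z' ((H - Z') \<union> (C - {c})) \<le> R (Z \<union> Z') (((H - Z) \<union> (C - {c})) \<inter> ((H - Z') \<union> C))"
      using that(1) by (intro rank_mono) auto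
    moreover have "R Z ((H - Z) \<union> C) \<le> R (Z \<inter> Z') (((H - Z) \<union> (C - {c})) \<union> ((H - Z') \<union> C))"
      using that(1) by (intro rank_mono) auto
    ultimately show ?thesis using that by linarith
  qed
  have critical_all: "D = {} \<or> (\<exists>Z. critical Z D)" if "finite D" "D \<subseteq> C" for D
    using that
  proof (induction D rule: finite_induct)
    case empty
    then show ?case by simp
  next
    case (insert c D)
    obtain Z2 where Z2: "critical Z2 {c}" using critical_single insert.prems by blast
    show ?case
    proof (cases "D = {}")
      case True
      then show ?thesis using Z2 by blast
    next
      case False
      then obtain Z1 where Z1: "critical Z1 D" using insert by auto
      \<comment> \<open>Uncrossing: \<open>Z1\<close> and \<open>Z2\<close> attain \<open>q\<close>,
        and \<open>q\<close> bounds union and intersection from below, so the union attains it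
        too.\<close>
      have "R (Z1 \<union> Z2) (((H - Z1) \<union> C) \<inter> ((H - Z2) \<union> C)) + R (Z1 \<inter> Z2) (((H - Z1) \<union> C) \<union> ((H - Z2) \<union> C))
          \<le> R Z1 ((H - Z1) \<union> C) + R Z2 ((H - Z2) \<union> C)"
        by (rule rank_submod)
      moreover have "((H - Z1) \<union> C) \<inter> ((H - Z2) \<union> C) = (H - (Z1 \<union> Z2)) \<union> C"
        "((H - Z1) \<union> C) \<union> ((H - Z2) \<union> C) = (H - (Z1 \<inter> Z2)) \<union> C" by auto
      moreover have "q \<le> R (Z1 \<inter> Z2) ((H - (Z1 \<inter> Z2)) \<union> C)" "q \<le> R (Z1 \<union> Z2) ((H - (Z1 \<union> Z2)) \<union> C)"
        using Z1 Z2 unfolding critical_def by (intro ge; blast)+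
      ultimately have tight: "R (Z1 \<union> Z2) ((H - (Z1 \<union> Z2)) \<union> C) = q"
        using Z1 Z2 by (simp add: critical_def)
      have "R (Z1 \<union> Z2) ((H - (Z1 \<union> Z2)) \<union> (C - {d})) < q" if "d \<in> insert c D" for d
      proof (cases "d \<in> D")
        case True
        then show ?thesis using critical_mono[of Z1 "Z1 \<union> Z2" d] tight Z1 by (simp add: critical_def)
      next
        case False
        then show ?thesis using that critical_mono[of Z2 "Z1 \<union> Z2" d] tight Z2 by (simp add: critical_def)
      qed
      then have "critical (Z1 \<union> Z2) (insert c D)"
        using tight Z1 Z2 by (simp add: critical_def le_supI1)
      then show ?thesis by blast
    qed
  qed
  have "card C \<le> q"
  proof (cases "C = {}")
    case False
    then obtain Z where Z: "critical Z C" using critical_all[OF finC] by auto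
    \<comment> \<open>At this \<open>Z\<close> each \<open>c\<close> in \<open>C\<close> has
      positive gain over all other columns, hence over fewer of them; adding them one by one counts
      \<open>C\<close>.\<close>
    have "card D \<le> R Z ((H - Z) \<union> D)" if "finite D" "D \<subseteq> C" for D
      using that
    proof (induction D rule: finite_induct)
      case (insert c D)
      have sub: "D \<subseteq> C - {c}" using insert by auto
      have "R (Z \<union> Z) (((H - Z) \<union> insert c D) \<inter> ((H - Z) \<union> (C - {c}))) +
          R (Z \<inter> Z) (((H - Z) \<union> insert c D) \<union> ((H - Z) \<union> (C - {c})))
          \<le> R Z ((H - Z) \<union> insert c D) + R Z ((H - Z) \<union> (C - {c}))"
        by (rule rank_submod)
      moreover have "R Z ((H - Z) \<union> D) \<le> R (Z \<union> Z) (((H - Z) \<union> insert c D) \<inter> ((H - Z) \<union> (C - {c})))"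
        using sub by (intro rank_mono) auto
      moreover have "R Z ((H - Z) \<union> C) \<le> R (Z \<inter> Z) (((H - Z) \<union> insert c D) \<union> ((H - Z) \<union> (C - {c})))"
        by (intro rank_mono) auto
      moreover have "R Z ((H - Z) \<union> (C - {c})) < R Z ((H - Z) \<union> C)"
        using Z insert.prems by (simp add: critical_def)
      moreover have "card D \<le> R Z ((H - Z) \<union> D)" using insert by auto
      ultimately show ?case using insert.hyps by simp
    qed simp
    then show ?thesis using Z finC by (auto simp: critical_def)
  qed simp
  \<comment> \<open>For \<open>Z = H\<close> the only remaining columns are those of
    \<open>C\<close>.\<close>
  moreover have "q \<le> card C"
    using ge[OF assms(1) subset_refl] rank_le_card[OF finC, of H] by simp
  ultimately show ?thesis using CV ge by (intro exI[of _ C]) auto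
qed

text \<open>
  The sets \<open>A\<close> below behave like the union of \<open>t\<close> disjoint sets of size \<open>q\<close>, each of them freely
  linked to \<open>S\<close> within \<open>S \<union> A\<close>.
\<close>

definition spread :: "'a set \<Rightarrow> nat \<Rightarrow> nat \<Rightarrow> 'a set \<Rightarrow> bool" where
  "spread S q t A \<longleftrightarrow> A \<subseteq> V - S \<and> card A = t * q \<and> (\<forall>X\<subseteq>A. card X \<le> t * R (S \<union> (A - X)) X)"

text \<open>A set \<open>C\<close> of \<open>q\<close> new columns is linked to \<open>S\<close>
  across every set between \<open>S\<close> and \<open>S \<union> A\<close>. For given
  \<open>X\<close>, the set \<open>S \<union> (A - X)\<close> shows that the rank is at least
  \<open>card (X \<inter> C)\<close>; the old bound covers \<open>X \<inter> A\<close> with factor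
  \<open>t\<close>, and the two add up to \<open>Suc t\<close>.\<close>

lemma spread_Suc:
  assumes A: "spread S q t A" and "S \<subseteq> V"
    and conn: "\<And>Z. S \<subseteq> Z \<Longrightarrow> Z \<subseteq> S \<union> A \<Longrightarrow> q \<le> cut Z"
  shows "\<exists>A'. spread S q (Suc t) A'"
proof -
  let ?H = "S \<union> A"
  have AV: "A \<subseteq> V - S" using A by (simp add: spread_def)
  have "\<exists>C \<subseteq> V - ?H. card C = q \<and> (\<forall>Z. S \<subseteq> Z \<longrightarrow> Z \<subseteq> ?H \<longrightarrow> q \<le> R Z ((?H - Z) \<union> C))"
    using AV assms(2) conn by (intro exists_linked_extension) auto
  then obtain C where C: "C \<subseteq> V - ?H" "card C = q"
      "\<And>Z. S \<subseteq> Z \<Longrightarrow> Z \<subseteq> ?H \<Longrightarrow> q \<le> R Z ((?H - Z) \<union> C)" by blast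
  have fin: "finite A" "finite C" using AV C(1) finite_V finite_subset by blast+
  have "card X \<le> Suc t * R (S \<union> (A \<union> C - X)) X" if X: "X \<subseteq> A \<union> C" for X
  proof -
    let ?ra = "R (S \<union> (A \<union> C - X)) X"
    have "card (X \<inter> A) \<le> t * R (S \<union> (A - X \<inter> A)) (X \<inter> A)"
      using A by (simp add: spread_def)
    also have "\<dots> \<le> t * ?ra"
      by (intro mult_le_mono2 rank_mono) auto
    finally have 1: "card (X \<inter> A) \<le> t * ?ra" .
    have "q \<le> R (S \<union> (A - X)) ((?H - (S \<union> (A - X))) \<union> C)" by (rule C(3)) auto
    also have "\<dots> \<le> R (S \<union> (A \<union> C - X)) (X \<union> (C - X))"
      by (intro rank_mono) auto
    also have "\<dots> \<le> ?ra + R (S \<union> (A \<union> C - X)) (C - X)" by (rule rank_Un_right_le)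
    also have "\<dots> \<le> ?ra + card (C - X)" using rank_le_card fin by simp
    finally have "card C \<le> ?ra + card (C - X)" using C(2) by simp
    moreover have "card C = card (X \<inter> C) + card (C - X)"
      using card_Diff_subset_Int[of C X] fin card_mono[of C "C \<inter> X"] by (simp add: Int_commute)
    ultimately have 2: "card (X \<inter> C) \<le> ?ra" by simp
    have "X = (X \<inter> A) \<union> (X \<inter> C)" using X by auto
    then have "card X \<le> card (X \<inter> A) + card (X \<inter> C)" by (metis card_Un_le)
    then show ?thesis using 1 2 by simp
  qed
  moreover have "card (A \<union> C) = Suc t * q"
    using A C fin by (subst card_Un_disjoint) (auto simp: spread_def)
  moreover have "A \<union> C \<subseteq> V - S" using AV C(1) by auto
  ultimately show ?thesis unfolding spread_def by blast
qed

text \<open>\<open>spread_Suc\<close> is iterated up to the least sufficient number of rounds.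
  Before that \<open>card A < 8 * card S\<close>, so all sets between \<open>S\<close> and
  \<open>S \<union> A\<close> are small enough for \<open>conn\<close>.\<close>

lemma exists_spread:
  assumes "S \<subseteq> V" "1 \<le> q"
    and conn: "\<And>Z. S \<subseteq> Z \<Longrightarrow> Z \<subseteq> V \<Longrightarrow> card Z \<le> 9 * card S \<Longrightarrow> q \<le> cut Z"
  shows "\<exists>t A. spread S q t A \<and> 8 * card S \<le> t * q"
proof -
  define t where "t = (LEAST t. 8 * card S \<le> t * q)"
  have "8 * card S \<le> (8 * card S) * q" using assms(2) by simp
  then have t: "8 * card S \<le> t * q" unfolding t_def by (rule LeastI)
  have "\<exists>A. spread S q i A" if "i \<le> t" for i
    using that
  proof (induction i)
    case 0
    have "spread S q 0 {}" by (simp add: spread_def)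
    then show ?case by blast
  next
    case (Suc i)
    then obtain A where A: "spread S q i A" by auto
    have "\<not> 8 * card S \<le> i * q" using Suc.prems not_less_Least[of i "\<lambda>t. 8 * card S \<le> t * q"]
      by (simp add: t_def)
    then have cardA: "card A < 8 * card S" and AV: "A \<subseteq> V - S" using A by (auto simp: spread_def)
    have fin: "finite (S \<union> A)" using AV assms(1) finite_V by (meson Diff_subset finite_subset le_sup_iff subset_trans)
    show ?case
    proof (rule spread_Suc[OF A assms(1)])
      fix Z assume Z: "S \<subseteq> Z" "Z \<subseteq> S \<union> A"
      have "card Z \<le> card (S \<union> A)" using Z fin by (intro card_mono)
      also have "\<dots> \<le> card S + card A" by (rule card_Un_le)
      finally have "card Z \<le> 9 * card S" using cardA by simp
      then show "q \<le> cut Z" using Z AV assms(1) by (intro conn) auto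
    qed
  qed
  then show ?thesis using t by blast
qed

text \<open>
  A large spread set meets both sides of a balanced cut of \<open>S \<union> A\<close> substantially, so both sides
  see many independent columns of \<open>S\<close>; this keeps the cut-ranks of the two parts of \<open>S\<close> small.
\<close>

lemma splits_if_spread:
  assumes A: "spread S (12 * r) t A" "8 * card S \<le> t * (12 * r)" and "S \<subseteq> V" "S \<noteq> {}" "1 \<le> r" "cut S \<le> k"
    and XY: "X \<union> Y = S \<union> A" "X \<inter> Y = {}" "3 * card X \<le> 2 * card (S \<union> A)" "3 * card Y \<le> 2 * card (S \<union> A)"
      "R X Y < r"
  shows "splits k S"
proof -
  have AV: "A \<subseteq> V - S" and cardA: "card A = t * (12 * r)" using A by (auto simp: spread_def)
  have finA: "finite A" using AV finite_V finite_subset by blast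
  have finS: "finite S" using \<open>S \<subseteq> V\<close> finite_V finite_subset by blast
  have cardU: "card (S \<union> A) = card S + card A" using AV finS finA by (intro card_Un_disjoint) auto
  have "card S > 0" using finS \<open>S \<noteq> {}\<close> by (simp add: card_gt_0_iff)
  then have "t > 0" using A(2) by (cases t) auto
  have side: "2 * r < R S (X \<inter> A)"
    if "X \<union> Y = S \<union> A" "X \<inter> Y = {}" "3 * card Y \<le> 2 * card (S \<union> A)" "R X Y < r" for X Y
  proof -
    have fin: "finite X" "finite Y" using that(1) finS finA by (metis finite_Un)+
    have "card X + card Y = card S + card A"
      using that(1,2) fin cardU card_Un_disjoint[of X Y] by simp
    moreover have "card X \<le> card (X \<inter> A) + card S"
    proof -
      have "X = (X \<inter> A) \<union> (X \<inter> S)" using that(1) by auto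
      then have "card X \<le> card (X \<inter> A) + card (X \<inter> S)" by (metis card_Un_le)
      also have "card (X \<inter> S) \<le> card S" using finS by (intro card_mono) auto
      finally show ?thesis by simp
    qed
    \<comment> \<open>\<open>X\<close> has at least a third of \<open>S \<union> A\<close>, of which
      at most \<open>card S\<close> lies outside \<open>A\<close>, and \<open>card S\<close> is at
      most an eighth of \<open>card A\<close>: 1/3 - (2/3)(1/8) = 1/4.\<close>
    ultimately have "card A \<le> 4 * card (X \<inter> A)" using that(3) cardU cardA A(2) by linarith
    also have "\<dots> \<le> 4 * (t * R (S \<union> (A - X \<inter> A)) (X \<inter> A))"
      using A(1) by (simp add: spread_def)
    finally have "t * (12 * r) \<le> t * (4 * R (S \<union> (A - X \<inter> A)) (X \<inter> A))" using cardA by simp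
    then have "3 * r \<le> R (S \<union> (A - X \<inter> A)) (X \<inter> A)" using \<open>t > 0\<close> by simp
    also have "\<dots> \<le> R S (X \<inter> A) + R (A - X \<inter> A) (X \<inter> A)" by (rule rank_Un_left_le)
    \<comment> \<open>Rows of \<open>A\<close> outside \<open>X\<close> lie in \<open>Y\<close> and
      contribute less than \<open>r\<close>; more than \<open>2 * r\<close> is left for the rows
      \<open>S\<close>.\<close>
    also have "R (A - X \<inter> A) (X \<inter> A) \<le> R Y X" using that(1) by (intro rank_mono) auto
    also have "R Y X = R X Y" by (rule rank_sym)
    finally show ?thesis using that(4) by linarith
  qed
  have sideX: "2 * r < R S (X \<inter> A)" using side[of X Y] XY by blast
  have sideY: "2 * r < R S (Y \<inter> A)"
    using side[of Y X] XY by (metis Int_commute Un_commute rank_sym)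
  have "indep S {}" using rank_le_card[of "{}" S] by (simp add: indep_def)
  \<comment> \<open>A basis \<open>B\<close> of the columns outside \<open>S\<close> is prepared
    that contains \<open>r\<close> columns of \<open>X\<close>, the set \<open>I\<close>, and
    \<open>r\<close> columns of \<open>Y\<close>, the set \<open>J - I\<close>.\<close>
  then obtain I where I: "I \<subseteq> X \<inter> A" "indep S I" "card I = r"
    using indep_extend_card[of S "{}" "X \<inter> A" r] sideX finA by auto
  have "R S (Y \<inter> A) \<le> R S (I \<union> (Y \<inter> A))" by (intro rank_mono) auto
  then have "2 * r \<le> R S (I \<union> (Y \<inter> A))" using sideY by linarith
  moreover have finI: "finite I" using I by (simp add: indep_def)
  ultimately obtain J where J: "I \<subseteq> J" "J \<subseteq> I \<union> (Y \<inter> A)" "indep S J" "card J = 2 * r"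
    using indep_extend_card[of S I "I \<union> (Y \<inter> A)" "2 * r"] I finA by auto
  obtain B where B: "J \<subseteq> B" "B \<subseteq> V - S" "indep S B" "R S (V - S) = card B"
    using indep_extend[of S J "V - S"] J I AV finite_V by (metis Diff_subset Int_lower2 finite_subset le_sup_iff subset_trans)
  have cardB: "card B \<le> k" using B(4) \<open>cut S \<le> k\<close> by (simp add: cut_def)
  have finB: "finite B" using B by (simp add: indep_def)
  \<comment> \<open>\<open>B\<close> replaces the columns outside \<open>S\<close>. Its
    \<open>r\<close> members \<open>D\<close> lie in \<open>Y'\<close> and are absorbed, with
    \<open>S \<inter> Y'\<close>, by the cut between \<open>X'\<close> and \<open>Y'\<close> of rank
    less than \<open>r\<close>, so the total stays below \<open>card B\<close>.\<close>
  have part: "cut (S \<inter> X') \<le> k"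
    if "X' \<union> Y' = S \<union> A" "X' \<inter> Y' = {}" "R X' Y' < r" "D \<subseteq> B" "D \<subseteq> Y'" "card D = r" for X' Y' D
  proof -
    have "cut (S \<inter> X') \<le> R (S \<inter> X') ((V - S) \<union> (S \<inter> Y'))"
      unfolding cut_def using that(1,2) by (intro rank_mono) auto
    also have "\<dots> \<le> R (S \<inter> X') (B \<union> (S \<inter> Y'))"
      by (rule basis_spans[of _ _ S]) (use B in \<open>auto simp: indep_def\<close>)
    also have "\<dots> \<le> R (S \<inter> X') (Y' \<union> (B - D))"
      using that by (intro rank_mono) auto
    also have "\<dots> \<le> R (S \<inter> X') Y' + R (S \<inter> X') (B - D)" by (rule rank_Un_right_le)
    also have "R (S \<inter> X') Y' \<le> R X' Y'" by (intro rank_mono) auto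
    also have "R (S \<inter> X') (B - D) \<le> card (B - D)" using finB by (intro rank_le_card) simp
    also have "card (B - D) = card B - r"
      using that(4,6) finB by (metis card_Diff_subset finite_subset)
    finally have "cut (S \<inter> X') \<le> R X' Y' + (card B - r)" by simp
    moreover have "r \<le> card B" using that(4,6) finB card_mono by metis
    ultimately show ?thesis using that(3) cardB by linarith
  qed
  have "cut (S \<inter> X) \<le> k"
  proof (rule part[of X Y "J - I"])
    show "card (J - I) = r" using I J finI by (simp add: card_Diff_subset)
  qed (use XY I J B in auto)
  moreover have "cut (S \<inter> Y) \<le> k"
    by (rule part[of Y X I]) (use XY I J B rank_sym[of X Y] in auto)
  moreover have "S \<inter> X \<noteq> {}"
  proof
    assume "S \<inter> X = {}"
    then have "S \<subseteq> Y" using XY(1) by auto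
    then have "R S (X \<inter> A) \<le> R Y X" by (intro rank_mono) auto
    then show False using sideX XY(5) rank_sym[of X Y] by simp
  qed
  moreover have "S \<inter> Y \<noteq> {}"
  proof
    assume "S \<inter> Y = {}"
    then have "S \<subseteq> X" using XY(1) by auto
    then have "R S (Y \<inter> A) \<le> R X Y" by (intro rank_mono) auto
    then show False using sideY XY(5) by simp
  qed
  moreover have "(S \<inter> X) \<union> (S \<inter> Y) = S" "(S \<inter> X) \<inter> (S \<inter> Y) = {}" using XY(1,2) by auto
  ultimately show ?thesis unfolding splits_def by blast
qed

text \<open>\<open>bal\<close> serves twice: on smallest big sets, to make their sizes shrink
  geometrically, and on \<open>S \<union> A\<close>, to split \<open>S\<close>. Both give two parts
  of low cut-rank, one of which is big because \<open>W\<close> is well-linked.\<close>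

lemma not_well_linked:
  assumes bal: "\<And>U. U \<subseteq> V \<Longrightarrow> 2 \<le> card U \<Longrightarrow>
      \<exists>X Y. X \<union> Y = U \<and> X \<inter> Y = {} \<and> 3 * card X \<le> 2 * card U \<and> 3 * card Y \<le> 2 * card U \<and> R X Y < r"
    and "1 \<le> r" and W: "well_linked W" "card W = 72 * r - 1"
  shows False
proof -
  define big where "big Z \<longleftrightarrow> Z \<subseteq> V \<and> 24 * r \<le> card (W \<inter> Z)" for Z
  have WV: "W \<subseteq> V" and finW: "finite W" using W finite_V finite_subset by (auto simp: well_linked_def)
  have big_mono: "big Z'" if "big Z" "Z \<subseteq> Z'" "Z' \<subseteq> V" for Z Z'
  proof -
    have "card (W \<inter> Z) \<le> card (W \<inter> Z')" using finW that(2) by (intro card_mono) auto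
    then show ?thesis using that by (simp add: big_def)
  qed
  have big_finite: "finite Z" if "big Z" for Z
    using that finite_V finite_subset by (auto simp: big_def)
  have big_card: "24 * r \<le> card Z" if "big Z" for Z
    using that big_finite[OF that] card_mono[of Z "W \<inter> Z"] by (simp add: big_def)
  \<comment> \<open>Otherwise well-linkedness leaves fewer than \<open>24 * r\<close> elements of
    \<open>W\<close> outside the union, and \<open>W\<close> has at most
    \<open>3 * (24 * r - 1)\<close> elements, fewer than \<open>72 * r - 1\<close>.\<close>
  have big_part: "big Z1 \<or> big Z2" if "big (Z1 \<union> Z2)" "cut (Z1 \<union> Z2) < 24 * r" for Z1 Z2
  proof (rule ccontr)
    assume "\<not> ?thesis"
    then have "card (W \<inter> Z1) < 24 * r" "card (W \<inter> Z2) < 24 * r" using that(1) by (auto simp: big_def)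
    moreover have "card (W \<inter> (Z1 \<union> Z2)) \<le> card (W \<inter> Z1) + card (W \<inter> Z2)"
      using card_Un_le[of "W \<inter> Z1" "W \<inter> Z2"] by (simp add: Int_Un_distrib)
    moreover have "min (card (W \<inter> (Z1 \<union> Z2))) (card (W - (Z1 \<union> Z2))) \<le> cut (Z1 \<union> Z2)"
      using W(1) that(1) unfolding well_linked_def big_def by blast
    then have "card (W - (Z1 \<union> Z2)) < 24 * r"
      using that unfolding big_def by linarith
    moreover have "card W \<le> card (W \<inter> (Z1 \<union> Z2)) + card (W - (Z1 \<union> Z2))"
      using card_Un_le[of "W \<inter> (Z1 \<union> Z2)" "W - (Z1 \<union> Z2)"] by (simp add: Int_Diff_Un)
    ultimately show False using W(2) \<open>1 \<le> r\<close> by linarith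
  qed
  define s where "s k = (LEAST n. \<exists>Z. big Z \<and> cut Z \<le> k \<and> card Z = n)" for k
  have s_le: "s k \<le> card Z" if "big Z" "cut Z \<le> k" for k Z
    unfolding s_def by (rule Least_le) (use that in blast)
  have "card W \<le> card (W \<inter> V)" using WV by (simp add: Int_absorb2)
  then have "big V" using W(2) \<open>1 \<le> r\<close> by (simp add: big_def)
  have s_ex: "\<exists>Z. big Z \<and> cut Z \<le> k \<and> card Z = s k" for k
    unfolding s_def
  proof (rule LeastI_ex)
    show "\<exists>n Z. big Z \<and> cut Z \<le> k \<and> card Z = n"
      using \<open>big V\<close> rank_empty rank_sym[of V "{}"] by (intro exI[of _ "card V"] exI[of _ V]) (simp add: cut_def)
  qed
  have shrink: "3 * s (k + r) \<le> 2 * s k" if "k < 24 * r" for k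
  proof -
    note k = that
    obtain Z where Z: "big Z" "cut Z \<le> k" "card Z = s k" using s_ex by blast
    have "Z \<subseteq> V" using Z(1) by (simp add: big_def)
    moreover have "2 \<le> card Z" using big_card[OF Z(1)] \<open>1 \<le> r\<close> by linarith
    ultimately have "\<exists>X Y. X \<union> Y = Z \<and> X \<inter> Y = {} \<and> 3 * card X \<le> 2 * card Z \<and> 3 * card Y \<le> 2 * card Z \<and> R X Y < r"
      by (rule bal)
    then obtain X Y where XY: "X \<union> Y = Z" "X \<inter> Y = {}" "3 * card X \<le> 2 * card Z"
        "3 * card Y \<le> 2 * card Z" "R X Y < r" by blast
    \<comment> \<open>Splitting \<open>Z\<close> adds to its cut-rank only the rank between the two
      parts.\<close>
    have part: "cut X' \<le> k + r" if "X' \<union> Y' = Z" "R X' Y' < r" for X' Y'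
    proof -
      have "cut X' \<le> R X' ((V - Z) \<union> Y')" unfolding cut_def using that(1) by (intro rank_mono) auto
      also have "\<dots> \<le> R X' (V - Z) + R X' Y'" by (rule rank_Un_right_le)
      also have "R X' (V - Z) \<le> cut Z" unfolding cut_def using that(1) by (intro rank_mono) auto
      finally show ?thesis using Z(2) that(2) by linarith
    qed
    have "big X \<or> big Y" using big_part[of X Y] Z(1,2) k unfolding XY(1) by linarith
    then show ?thesis
    proof
      assume "big X"
      then show ?thesis using s_le[OF _ part[of X Y]] XY Z(3) by fastforce
    next
      assume "big Y"
      then show ?thesis using s_le[OF _ part[of Y X]] XY Z(3) rank_sym[of X Y] by fastforce
    qed
  qed
  \<comment> \<open>Six rounds lead from \<open>12 * r - 1\<close> to \<open>18 * r - 1\<close>, and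
    six are enough because (3/2)^6 = 729/64 exceeds 9.\<close>
  have shrinks: "3 ^ i * s (12 * r - 1 + i * r) \<le> 2 ^ i * s (12 * r - 1)" if "i \<le> 6" for i
    using that
  proof (induction i)
    case (Suc i)
    have "i * r \<le> 5 * r" using Suc.prems by simp
    then have "12 * r - 1 + i * r < 24 * r" using \<open>1 \<le> r\<close> by linarith
    then have "3 * s (12 * r - 1 + i * r + r) \<le> 2 * s (12 * r - 1 + i * r)" by (rule shrink)
    then have "3 ^ i * (3 * s (12 * r - 1 + i * r + r)) \<le> 3 ^ i * (2 * s (12 * r - 1 + i * r))" by simp
    also have "\<dots> \<le> 2 * (2 ^ i * s (12 * r - 1))" using Suc by simp
    finally show ?case by (simp add: algebra_simps)
  qed simp
  define k where "k = 18 * r - 1"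
  have "12 * r - 1 + 6 * r = k" using \<open>1 \<le> r\<close> by (simp add: k_def)
  then have ratio: "729 * s k \<le> 64 * s (12 * r - 1)" using shrinks[of 6] by simp
  obtain S where S: "big S" "cut S \<le> k" "card S = s k" using s_ex by blast
  have "S \<subseteq> V" using S(1) by (simp add: big_def)
  have posS: "0 < card S" using big_card[OF S(1)] \<open>1 \<le> r\<close> by simp
  \<comment> \<open>Supersets of \<open>S\<close> are big, so one of cut-rank at most
    \<open>12 * r - 1\<close> has at least 729/64 times the size of \<open>S\<close>.\<close>
  have "12 * r \<le> cut Z" if "S \<subseteq> Z" "Z \<subseteq> V" "card Z \<le> 9 * card S" for Z
  proof (rule ccontr)
    assume "\<not> ?thesis"
    then have "s (12 * r - 1) \<le> card Z" using s_le[of Z] big_mono[OF S(1) that(1,2)] by simp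
    then show False using ratio that(3) posS S(3) by linarith
  qed
  then obtain t A where A: "spread S (12 * r) t A" "8 * card S \<le> t * (12 * r)"
    using exists_spread[of S "12 * r"] \<open>S \<subseteq> V\<close> \<open>1 \<le> r\<close> by fastforce
  have SA: "S \<union> A \<subseteq> V" using A(1) \<open>S \<subseteq> V\<close> by (auto simp: spread_def)
  then have "finite (S \<union> A)" using finite_V finite_subset by blast
  then have "card S \<le> card (S \<union> A)" by (intro card_mono) auto
  then have "2 \<le> card (S \<union> A)" using big_card[OF S(1)] \<open>1 \<le> r\<close> by linarith
  from bal[OF SA this] obtain X Y where "X \<union> Y = S \<union> A" "X \<inter> Y = {}" "3 * card X \<le> 2 * card (S \<union> A)"
      "3 * card Y \<le> 2 * card (S \<union> A)" "R X Y < r"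
    by blast
  moreover have "S \<noteq> {}" using posS by auto
  ultimately have "splits k S"
    using splits_if_spread[OF A \<open>S \<subseteq> V\<close> _ \<open>1 \<le> r\<close> S(2)] by blast
  then obtain S1 S2 where S12: "S1 \<union> S2 = S" "S1 \<inter> S2 = {}" "S1 \<noteq> {}" "S2 \<noteq> {}" "cut S1 \<le> k" "cut S2 \<le> k"
    unfolding splits_def by blast
  have "k < 24 * r" using \<open>1 \<le> r\<close> by (simp add: k_def)
  then have "big S1 \<or> big S2" using big_part[of S1 S2] S(1,2) unfolding S12(1) by linarith
  then have "s k \<le> card S1 \<or> s k \<le> card S2" using s_le S12 by blast
  moreover have "card S1 < card S" "card S2 < card S"
    using S12 posS by (auto intro!: psubset_card_mono simp: card_gt_0_iff)
  ultimately show False using S(3) by linarith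
qed

end

section \<open>Rank over the two-element field\<close>

text \<open>A constant for the scalar multiplication keeps the simplifier from normalising products of bits.\<close>

definition F2_smult :: "bit \<Rightarrow> ('b \<Rightarrow> bit) \<Rightarrow> 'b \<Rightarrow> bit" where
  "F2_smult = F2_scale"

lemma F2_smult_apply: "F2_smult c v y = c * v y"
  unfolding F2_smult_def ..

interpretation F2: vector_space "F2_smult :: bit \<Rightarrow> ('b \<Rightarrow> bit) \<Rightarrow> 'b \<Rightarrow> bit"
  unfolding F2_smult_def by (rule vector_space_F2_scale)

lemma (in vector_space) dim_insert_finite:
  assumes "finite S"
  shows "dim (insert v S) = (if v \<in> span S then dim S else Suc (dim S))"
proof (cases "v \<in> span S")
  case True
  then have "span (insert v S) = span S" by (rule span_redundant)
  then have "dim (insert v S) = dim S" by (rule span_eq_dim)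
  then show ?thesis using True by simp
next
  case False
  obtain B where B: "B \<subseteq> S" "independent B" "S \<subseteq> span B" "card B = dim S"
    using basis_exists[of S] by blast
  have "span B = span S" using B by (intro subset_antisym span_mono span_minimal subspace_span)
  then have vB: "v \<notin> span B" using False by simp
  then have "independent (insert v B)" using B(2) by (intro independent_insertI)
  moreover have "insert v S \<subseteq> span (insert v B)"
    using B(3) span_mono[of B "insert v B"] by (auto intro: span_base)
  moreover have "insert v B \<subseteq> insert v S" using B(1) by auto
  ultimately have "dim (insert v S) = card (insert v B)" by (metis dim_unique)
  moreover have "v \<notin> B" using vB span_base by blast
  ultimately show ?thesis using False B assms finite_subset[of B S] by simp
qed

definition F2_row :: "'b set \<Rightarrow> ('a \<Rightarrow> 'b \<Rightarrow> bit) \<Rightarrow> 'a \<Rightarrow> 'b \<Rightarrow> bit" where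
  "F2_row Y M x = (\<lambda>y. if y \<in> Y then M x y else 0)"

lemma F2_rank_altdef: "F2_rank X Y M = F2.dim (F2_row Y M ` X)"
  unfolding F2_rank_def F2_row_def[abs_def] F2_smult_def ..

lemma F2_rank_cong:
  assumes "\<And>x y. x \<in> X \<Longrightarrow> y \<in> Y \<Longrightarrow> M x y = N x y"
  shows "F2_rank X Y M = F2_rank X Y N"
proof -
  have "F2_row Y M ` X = F2_row Y N ` X"
    using assms by (intro image_cong) (auto simp: F2_row_def fun_eq_iff)
  then show ?thesis by (simp add: F2_rank_altdef)
qed

lemma F2_rank_insert:
  assumes "finite X"
  shows "F2_rank (insert x X) Y M =
    (if F2_row Y M x \<in> F2.span (F2_row Y M ` X) then F2_rank X Y M else Suc (F2_rank X Y M))"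
  unfolding F2_rank_altdef image_insert by (rule F2.dim_insert_finite) (use assms in simp)

text \<open>Truncation to the columns \<open>Y'\<close> is linear, so it carries linear dependences
  between rows over.\<close>

lemma F2_row_span_mono:
  assumes "F2_row Y M x \<in> F2.span (F2_row Y M ` X)" "X \<subseteq> X'" "Y' \<subseteq> Y"
  shows "F2_row Y' M x \<in> F2.span (F2_row Y' M ` X')"
proof -
  define p :: "('a \<Rightarrow> bit) \<Rightarrow> 'a \<Rightarrow> bit" where "p f = (\<lambda>y. if y \<in> Y' then f y else 0)" for f
  have p_row: "p (F2_row Y M z) = F2_row Y' M z" for z
    using assms(3) by (auto simp: p_def F2_row_def fun_eq_iff)
  have "p v \<in> F2.span (F2_row Y' M ` X')" if "v \<in> F2.span (F2_row Y M ` X)" for v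
    using that
  proof (induction rule: F2.span_induct_alt)
    case base
    have "p 0 = 0" by (auto simp: p_def)
    then show ?case using F2.span_zero by metis
  next
    case (step c w v)
    have "p (F2_smult c w + v) = F2_smult c (p w) + p v" by (auto simp: p_def F2_smult_apply)
    moreover have "p w \<in> F2.span (F2_row Y' M ` X')"
      using step(1) assms(2) p_row by (auto intro: F2.span_base)
    ultimately show ?case using step(2) by (simp only: F2.span_add F2.span_scale)
  qed
  from this[OF assms(1)] show ?thesis unfolding p_row .
qed

text \<open>A row that depends on the rows \<open>X\<close> within the columns \<open>Y\<close>
  still depends on more rows within fewer columns, so each row of \<open>F\<close> raises the rank
  of \<open>(X', Y')\<close> no more than that of \<open>(X, Y)\<close>.\<close>

lemma F2_rank_rows_diminishing:
  assumes "finite X'" "finite F" "X \<subseteq> X'" "Y' \<subseteq> Y"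
  shows "F2_rank (X' \<union> F) Y' M + F2_rank X Y M \<le> F2_rank (X \<union> F) Y M + F2_rank X' Y' M"
  using assms(2)
proof (induction F rule: finite_induct)
  case empty
  then show ?case by simp
next
  case (insert x F)
  have fin: "finite (X' \<union> F)" "finite (X \<union> F)" using assms insert finite_subset[of X X'] by auto
  have sub: "X \<union> F \<subseteq> X' \<union> F" using assms(3) by auto
  have "F2_rank (insert x (X' \<union> F)) Y' M + F2_rank (X \<union> F) Y M
      \<le> F2_rank (insert x (X \<union> F)) Y M + F2_rank (X' \<union> F) Y' M"
    using F2_row_span_mono[OF _ sub assms(4), of M x] by (simp add: F2_rank_insert[OF fin(1)] F2_rank_insert[OF fin(2)])
  then show ?case using insert.IH by simp
qed

lemma sum_fun_apply: "(\<Sum>w\<in>W. f w) y = (\<Sum>w\<in>W. f w y)"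
  by (induction W rule: infinite_finite_induct) simp_all

text \<open>A spanning set of \<open>n\<close> columns factors the matrix through \<open>n\<close> and so yields \<open>n\<close> vectors spanning the rows.\<close>

lemma F2_rank_le_transpose:
  assumes "finite Y"
  shows "F2_rank X Y M \<le> F2_rank Y X (\<lambda>y x. M x y)"
proof -
  let ?cols = "F2_row X (\<lambda>y x. M x y) ` Y"
  obtain W where W: "W \<subseteq> ?cols" "?cols \<subseteq> F2.span W" "card W = F2.dim ?cols"
    by (rule F2.basis_exists)
  have finW: "finite W" using W(1) assms finite_subset by blast
  have "\<exists>c. F2_row X (\<lambda>y x. M x y) y = (\<Sum>w\<in>W. F2_smult (c w) w)" if "y \<in> Y" for y
  proof -
    have "F2_row X (\<lambda>y x. M x y) y \<in> F2.span W" using W(2) that by blast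
    then show ?thesis unfolding F2.span_finite[OF finW] by auto
  qed
  then obtain c where c: "\<And>y. y \<in> Y \<Longrightarrow> F2_row X (\<lambda>y x. M x y) y = (\<Sum>w\<in>W. F2_smult (c y w) w)"
    by metis
  \<comment> \<open>\<open>u w\<close> collects the coefficients of \<open>w\<close> over all
    columns, so row \<open>x\<close> is the combination of the \<open>u w\<close> with coefficients
    \<open>w x\<close>.\<close>
  define u where "u w = (\<lambda>y. if y \<in> Y then c y w else 0)" for w
  have "F2_row Y M x \<in> F2.span (u ` W)" if "x \<in> X" for x
  proof -
    have "F2_row Y M x y = (\<Sum>w\<in>W. F2_smult (w x) (u w)) y" for y
    proof (cases "y \<in> Y")
      case True
      have "F2_row Y M x y = F2_row X (\<lambda>y x. M x y) y x" using True that by (simp add: F2_row_def)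
      then show ?thesis using c[OF True] True by (simp add: sum_fun_apply u_def F2_smult_apply mult.commute conj_commute)
    qed (simp add: F2_row_def sum_fun_apply u_def F2_smult_apply)
    then have "F2_row Y M x = (\<Sum>w\<in>W. F2_smult (w x) (u w))" by blast
    also have "\<dots> \<in> F2.span (u ` W)"
      by (intro F2.span_sum F2.span_scale F2.span_base) auto
    finally show ?thesis .
  qed
  then have "F2.dim (F2_row Y M ` X) \<le> card (u ` W)"
    using finW by (intro F2.dim_le_card) auto
  also have "\<dots> \<le> card W" using finW by (rule card_image_le)
  finally show ?thesis using W(3) by (simp add: F2_rank_altdef)
qed

lemma F2_rank_transpose:
  assumes "finite X" "finite Y"
  shows "F2_rank X Y M = F2_rank Y X (\<lambda>y x. M x y)"
  using F2_rank_le_transpose[OF assms(2), of X M] F2_rank_le_transpose[OF assms(1), of Y "\<lambda>y x. M x y"]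
  by (rule order_antisym)

lemma F2_rank_cols_diminishing:
  assumes "finite X" "finite Y'" "finite F" "X' \<subseteq> X" "Y \<subseteq> Y'"
  shows "F2_rank X' (Y' \<union> F) M + F2_rank X Y M \<le> F2_rank X (Y \<union> F) M + F2_rank X' Y' M"
proof -
  have fin: "finite X'" "finite Y" using assms finite_subset by blast+
  then have "F2_rank X' (Y' \<union> F) M = F2_rank (Y' \<union> F) X' (\<lambda>y x. M x y)"
    "F2_rank X Y M = F2_rank Y X (\<lambda>y x. M x y)"
    "F2_rank X (Y \<union> F) M = F2_rank (Y \<union> F) X (\<lambda>y x. M x y)"
    "F2_rank X' Y' M = F2_rank Y' X' (\<lambda>y x. M x y)"
    using assms by (auto intro!: F2_rank_transpose)
  then show ?thesis using F2_rank_rows_diminishing[of Y' F Y X' X "\<lambda>y x. M x y"] assms by simp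
qed

text \<open>First the rows \<open>X2\<close>, then the columns \<open>Y1\<close> are added; in the
  sum of the two inequalities the mixed terms at \<open>(X1, Y1 \<inter> Y2)\<close> and
  \<open>(X1 \<inter> X2, Y2)\<close> cancel.\<close>

lemma F2_rank_submodular:
  assumes "finite X1" "finite X2" "finite Y1" "finite Y2"
  shows "F2_rank (X1 \<union> X2) (Y1 \<inter> Y2) M + F2_rank (X1 \<inter> X2) (Y1 \<union> Y2) M
    \<le> F2_rank X1 Y1 M + F2_rank X2 Y2 M"
proof -
  have "F2_rank (X1 \<union> X2) (Y1 \<inter> Y2) M + F2_rank (X1 \<inter> X2) Y2 M
      \<le> F2_rank ((X1 \<inter> X2) \<union> X2) Y2 M + F2_rank X1 (Y1 \<inter> Y2) M"
    using assms by (intro F2_rank_rows_diminishing) auto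
  moreover have "F2_rank (X1 \<inter> X2) (Y2 \<union> Y1) M + F2_rank X1 (Y1 \<inter> Y2) M
      \<le> F2_rank X1 ((Y1 \<inter> Y2) \<union> Y1) M + F2_rank (X1 \<inter> X2) Y2 M"
    using assms by (intro F2_rank_cols_diminishing) auto
  moreover have "(X1 \<inter> X2) \<union> X2 = X2" "(Y1 \<inter> Y2) \<union> Y1 = Y1" "Y2 \<union> Y1 = Y1 \<union> Y2" by auto
  ultimately show ?thesis by simp
qed

lemma F2_rank_empty_rows: "F2_rank {} Y M = 0"
  using F2.dim_le_card[of "{}" "{}"] by (simp add: F2_rank_altdef)

lemma F2_rank_mono_rows:
  assumes "finite X'" "X \<subseteq> X'"
  shows "F2_rank X Y M \<le> F2_rank X' Y M"
proof -
  obtain B where B: "B \<subseteq> F2_row Y M ` X'" "F2_row Y M ` X' \<subseteq> F2.span B" "card B = F2_rank X' Y M"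
    unfolding F2_rank_altdef by (rule F2.basis_exists)
  have "finite B" using B(1) assms(1) by (auto intro: finite_subset)
  moreover have "F2_row Y M ` X \<subseteq> F2.span B" using B(2) assms(2) by blast
  ultimately have "F2_rank X Y M \<le> card B" unfolding F2_rank_altdef by (intro F2.dim_le_card)
  then show ?thesis using B(3) by simp
qed

lemma F2_rank_mono:
  assumes "finite X'" "finite Y'" "X \<subseteq> X'" "Y \<subseteq> Y'"
  shows "F2_rank X Y M \<le> F2_rank X' Y' M"
proof -
  have fin: "finite X" "finite Y" using assms finite_subset by blast+
  have "F2_rank X Y M = F2_rank Y X (\<lambda>y x. M x y)" by (rule F2_rank_transpose) fact+
  also have "\<dots> \<le> F2_rank Y' X (\<lambda>y x. M x y)" using assms by (intro F2_rank_mono_rows)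
  also have "\<dots> = F2_rank X Y' M" using fin(1) assms(2) by (rule F2_rank_transpose[symmetric])
  also have "\<dots> \<le> F2_rank X' Y' M" using assms by (intro F2_rank_mono_rows)
  finally show ?thesis .
qed

text \<open>The locale quantifies over all sets; intersecting with \<open>V\<close> keeps every
  submatrix finite, as needed for passing between rows and columns.\<close>

lemma rank_bifunction_F2_rank:
  assumes "finite V" and sym: "\<And>x y. M x y = M y x"
  shows "rank_bifunction (\<lambda>X Y. F2_rank (X \<inter> V) (Y \<inter> V) M)"
proof
  fix X Y X' Y' X1 X2 Y1 Y2 :: "'a set" and x
  have fin: "finite (Z \<inter> V)" for Z using \<open>finite V\<close> by simp
  have "(\<lambda>y x. M x y) = M" using sym by (simp add: fun_eq_iff)
  then show "F2_rank (X \<inter> V) (Y \<inter> V) M = F2_rank (Y \<inter> V) (X \<inter> V) M"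
    using F2_rank_transpose[OF fin fin, of X Y M] by simp
  show "F2_rank ({} \<inter> V) (Y \<inter> V) M = 0" by (simp add: F2_rank_empty_rows)
  have "F2_rank ({x} \<inter> V) (Y \<inter> V) M \<le> F2_rank {x} (Y \<inter> V) M"
    using fin by (intro F2_rank_mono) auto
  also have "\<dots> \<le> 1" using F2.dim_le_card'[of "{F2_row (Y \<inter> V) M x}"] by (simp add: F2_rank_altdef)
  finally show "F2_rank ({x} \<inter> V) (Y \<inter> V) M \<le> 1" .
  show "F2_rank (X \<inter> V) (Y \<inter> V) M \<le> F2_rank (X' \<inter> V) (Y' \<inter> V) M" if "X \<subseteq> X'" "Y \<subseteq> Y'"
    using that fin by (intro F2_rank_mono) auto
  have "F2_rank ((X1 \<inter> V) \<union> (X2 \<inter> V)) ((Y1 \<inter> V) \<inter> (Y2 \<inter> V)) M + F2_rank ((X1 \<inter> V) \<inter> (X2 \<inter> V)) ((Y1 \<inter> V) \<union> (Y2 \<inter> V)) M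
    \<le> F2_rank (X1 \<inter> V) (Y1 \<inter> V) M + F2_rank (X2 \<inter> V) (Y2 \<inter> V) M"
    by (intro F2_rank_submodular fin)
  moreover have "(X1 \<inter> V) \<union> (X2 \<inter> V) = (X1 \<union> X2) \<inter> V" "(Y1 \<inter> V) \<union> (Y2 \<inter> V) = (Y1 \<union> Y2) \<inter> V"
    "(X1 \<inter> V) \<inter> (X2 \<inter> V) = (X1 \<inter> X2) \<inter> V" "(Y1 \<inter> V) \<inter> (Y2 \<inter> V) = (Y1 \<inter> Y2) \<inter> V" by auto
  ultimately show "F2_rank ((X1 \<union> X2) \<inter> V) (Y1 \<inter> Y2 \<inter> V) M + F2_rank (X1 \<inter> X2 \<inter> V) ((Y1 \<union> Y2) \<inter> V) M
    \<le> F2_rank (X1 \<inter> V) (Y1 \<inter> V) M + F2_rank (X2 \<inter> V) (Y2 \<inter> V) M" by simp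
qed

section \<open>Trees from repeated splitting\<close>

lemma cas_nth:
  assumes "pcas u p v" "Suc i < length p"
  shows "snd (p ! i) = fst (p ! Suc i)"
  using assms
proof (induction p arbitrary: u i)
  case (Cons e p)
  then show ?case by (cases i; cases p) auto
qed simp

lemma cas_ends:
  assumes "pcas u p v" "p \<noteq> []"
  shows "fst (p ! 0) = u" "snd (p ! (length p - 1)) = v"
  using assms
proof (induction p arbitrary: u)
  case (Cons e p)
  case 1
  then show ?case by simp
next
  case (Cons e p)
  case 2
  then show ?case using Cons(2)[of "snd e"] by (cases p) auto
qed simp_all

lemma cas_verts: "pcas u p v \<Longrightarrow> pawalk_verts u p = u # map snd p"
  by (induction p arbitrary: u) auto

lemma delete_edge_commute: "delete_edge D a b = delete_edge D b a"
  by (simp add: delete_edge_def insert_commute)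

text \<open>
  The label of a tree vertex stands for the set of graph vertices placed at the leaves below it, so
  deleting the edge between \<open>x\<close> and its parent separates \<open>label x\<close> from \<open>V - label x\<close>.
\<close>

locale set_labelled_tree =
  fixes N :: "'b set" and root :: 'b and parent :: "'b \<Rightarrow> 'b" and label :: "'b \<Rightarrow> 'a set" and V :: "'a set"
  assumes finite_N: "finite N" and root_in: "root \<in> N" and label_root: "label root = V" and finite_V: "finite V"
    and label_nonempty: "x \<in> N \<Longrightarrow> label x \<noteq> {}"
    and label_subset: "x \<in> N \<Longrightarrow> label x \<subseteq> V"
    and inj_label: "inj_on label N"
    and singleton_label: "v \<in> V \<Longrightarrow> {v} \<in> label ` N"
    and parent_in: "x \<in> N \<Longrightarrow> x \<noteq> root \<Longrightarrow> parent x \<in> N"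
    and label_parent: "x \<in> N \<Longrightarrow> x \<noteq> root \<Longrightarrow> label x \<subset> label (parent x)"
    and parent_least: "x \<in> N \<Longrightarrow> y \<in> N \<Longrightarrow> label x \<subset> label y \<Longrightarrow> label (parent x) \<subseteq> label y"
    and card_children: "x \<in> N \<Longrightarrow> card {y \<in> N - {root}. parent y = x} = (if is_singleton (label x) then 0 else 2)"
begin

section \<open>The tree given by \<open>parent\<close> and its rank-decomposition\<close>

definition up :: "('b \<times> 'b) set" where
  "up = (\<lambda>x. (x, parent x)) ` (N - {root})"

definition T :: "'b pair_pre_digraph" where
  "T = \<lparr>pverts = N, parcs = up \<union> up\<inverse>\<rparr>"

lemma up_iff: "(x, y) \<in> up \<longleftrightarrow> x \<in> N \<and> x \<noteq> root \<and> y = parent x"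
  by (auto simp: up_def)

lemma T_simps [simp]: "pverts T = N" "parcs T = up \<union> up\<inverse>"
  by (simp_all add: T_def)

lemma up_label: "(x, y) \<in> up \<Longrightarrow> x \<in> N \<and> y \<in> N \<and> label x \<subset> label y"
  using parent_in label_parent by (auto simp: up_iff)

lemma finite_label: "x \<in> N \<Longrightarrow> finite (label x)"
  using label_subset finite_V finite_subset by blast

lemma up_card: "(x, y) \<in> up \<Longrightarrow> card (label x) < card (label y)"
  using up_label[of x y] finite_label psubset_card_mono by blast

lemma pair_graph_T: "pair_graph T"
proof
  have "finite up" using finite_N by (simp add: up_def)
  then show "finite (parcs T)" by simp
  show "finite (pverts T)" using finite_N by simp
  show "symmetric (with_proj T)" by (auto simp: symmetric_def sym_def)
qed (use up_label in fastforce)+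

text \<open>Climbing strictly enlarges labels inside the finite \<open>V\<close>, so the climb ends,
  and only \<open>y\<close> can stop it. The invariant \<open>P\<close> serves to keep it on one
  side of a deleted edge.\<close>

lemma up_reachable:
  assumes "x \<in> N" "E \<subseteq> up"
    and climb: "\<And>z. z \<in> N \<Longrightarrow> label x \<subseteq> label z \<Longrightarrow> z \<noteq> y \<Longrightarrow> P z \<Longrightarrow> z \<noteq> root \<and> (z, parent z) \<in> E \<and> P (parent z)"
    and "P x"
  shows "(x, y) \<in> E\<^sup>*"
  using assms
proof (induction "card V - card (label x)" arbitrary: x rule: less_induct)
  case less
  show ?case
  proof (cases "x = y")
    case False
    then have step: "x \<noteq> root" "(x, parent x) \<in> E" "P (parent x)" using less.prems(1,3,4) by blast+
    then have up: "(x, parent x) \<in> up" using assms(2) by blast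
    have px: "parent x \<in> N" "label x \<subseteq> label (parent x)" using up_label[OF up] by auto
    have "(parent x, y) \<in> E\<^sup>*"
    proof (rule less.hyps)
      have "card (label (parent x)) \<le> card V"
        using finite_V label_subset[OF px(1)] by (rule card_mono)
      then show "card V - card (label (parent x)) < card V - card (label x)"
        using up_card[OF up] by linarith
      show "z \<noteq> root \<and> (z, parent z) \<in> E \<and> P (parent z)"
        if "z \<in> N" "label (parent x) \<subseteq> label z" "z \<noteq> y" "P z" for z
        using less.prems(3)[of z] that px(2) by blast
    qed (use px(1) less.prems(2) step(3) in auto)
    then show ?thesis using step(2) by (rule converse_rtrancl_into_rtrancl[rotated])
  qed simp
qed

text \<open>
  On a closed walk, a vertex with a smallest label is entered from its parent and left to its
  parent, so a cycle has length at most 2.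
\<close>

lemma no_long_cycle: "\<not> (pre_digraph.cycle (with_proj T) p \<and> 3 \<le> length p)"
proof
  assume "pre_digraph.cycle (with_proj T) p \<and> 3 \<le> length p"
  then obtain u where "pre_digraph.awalk (with_proj T) u p u"
      "distinct (tl (pre_digraph.awalk_verts (with_proj T) u p))" and len: "3 \<le> length p"
    by (auto simp: pre_digraph.cycle_def)
  then have arcs: "set p \<subseteq> up \<union> up\<inverse>" and cas: "pcas u p u" and "distinct (tl (pawalk_verts u p))"
    by (auto simp: pre_digraph.awalk_def cas_with_proj_eq awalk_verts_with_proj_eq)
  then have dist: "distinct (map snd p)" by (simp add: cas_verts)
  define n where "n = length p"
  have n: "3 \<le> n" using len by (simp add: n_def)
  have "p \<noteq> []" using len by auto
  have next_arc: "snd (p ! i) = fst (p ! (Suc i mod n))" if "i < n" for i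
  proof (cases "Suc i < n")
    case True
    then show ?thesis using cas_nth[OF cas, of i] by (simp add: n_def)
  next
    case False
    then have "i = length p - 1" "Suc i mod n = 0" using that by (auto simp: n_def mod_Suc)
    then show ?thesis using cas_ends[OF cas \<open>p \<noteq> []\<close>] by simp
  qed
  obtain i where i: "i < n" and least: "\<And>j. j < n \<Longrightarrow> card (label (snd (p ! i))) \<le> card (label (snd (p ! j)))"
    using ex_has_least_nat[of "\<lambda>j. j < n" 0 "\<lambda>j. card (label (snd (p ! j)))"] n by auto
  \<comment> \<open>\<open>j\<close> and \<open>l\<close> are the cyclic successor and predecessor
    of \<open>i\<close>: arc \<open>i\<close> enters the vertex with a smallest label and arc
    \<open>j\<close> leaves it. Adding \<open>n\<close> avoids truncated subtraction at 0.\<close>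
  define j where "j = Suc i mod n"
  define l where "l = (i + n - 1) mod n"
  have jl: "j < n" "l < n" using n by (auto simp: j_def l_def)
  have li: "Suc l mod n = i" using i n by (cases "i = 0") (auto simp: l_def mod_Suc le_mod_geq)
  have into: "p ! i = (snd (p ! l), snd (p ! i))" using next_arc[OF jl(2)] li by (metis prod.collapse)
  have out: "p ! j = (snd (p ! i), snd (p ! j))" using next_arc[OF i] j_def by (metis prod.collapse)
  have mem: "p ! i \<in> up \<union> up\<inverse>" "p ! j \<in> up \<union> up\<inverse>" using arcs i jl nth_mem unfolding n_def by blast+
  have "(snd (p ! i), snd (p ! l)) \<in> up"
    using mem(1) into least[OF jl(2)] up_card by (metis UnE converse_iff not_less)
  moreover have "(snd (p ! i), snd (p ! j)) \<in> up"
    using mem(2) out least[OF jl(1)] up_card by (metis UnE converse_iff not_less)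
  ultimately have "snd (p ! l) = snd (p ! j)" by (simp add: up_iff)
  then have "map snd p ! l = map snd p ! j" using jl by (simp add: n_def)
  \<comment> \<open>Distinct vertices force predecessor and successor to coincide, which
    \<open>3 \<le> n\<close> excludes.\<close>
  then have "l = j" using dist jl nth_eq_iff_index_eq[of "map snd p" l j] by (simp add: n_def)
  then show False using i n li by (auto simp: j_def mod_Suc split: if_splits)
qed

lemma undirected_tree_T: "undirected_tree T"
proof -
  interpret pair_graph T by (rule pair_graph_T)
  have to_root: "(x, root) \<in> (up \<union> up\<inverse>)\<^sup>*" if "x \<in> N" for x
  proof -
    have "(x, root) \<in> up\<^sup>*"
      by (rule up_reachable[where P = "\<lambda>_. True"]) (use that in \<open>auto simp: up_iff\<close>)
    then show ?thesis by (rule rtrancl_mono[THEN subsetD, rotated]) auto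
  qed
  have "sym ((up \<union> up\<inverse>)\<^sup>*)" by (intro sym_rtrancl) (auto simp: sym_def)
  then have "(x, y) \<in> (up \<union> up\<inverse>)\<^sup>*" if "x \<in> N" "y \<in> N" for x y
    using to_root[OF that(1)] to_root[OF that(2)] by (meson rtrancl_trans symD)
  then have "x \<rightarrow>\<^sup>*\<^bsub>T\<^esub> y" if "x \<in> N" "y \<in> N" for x y
    using that reachable_conv'[of x y] by simp
  then have "Digraph_Component.connected T"
    unfolding Digraph_Component.connected_def
    by (intro strongly_connectedI) (use root_in reachable_mk_symmetricI in auto)
  then show ?thesis
    using pair_graph_T no_long_cycle by (auto simp: undirected_tree_def)
qed

lemma out_arcs_T:
  "out_arcs T x = (if x \<in> N - {root} then {(x, parent x)} else {}) \<union> Pair x ` {y \<in> N - {root}. parent y = x}"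
  by (auto simp: out_arcs_def up_def)

text \<open>A non-root vertex adds its parent to its zero or two children, so the degree is 0 or 1
  for singleton labels and 2 or 3 otherwise.\<close>

lemma out_degree_T:
  assumes "x \<in> N"
  shows "out_degree T x \<le> 3" and "out_degree T x \<le> 1 \<longleftrightarrow> is_singleton (label x)"
proof -
  let ?ch = "{y \<in> N - {root}. parent y = x}"
  have inj: "card (Pair x ` ?ch) = card ?ch" by (intro card_image) (auto simp: inj_on_def)
  have fin: "finite (Pair x ` ?ch)" using finite_N by simp
  have "out_degree T x \<le> 1 + card ?ch"
    unfolding out_degree_def out_arcs_T
    using card_Un_le[of "if x \<in> N - {root} then {(x, parent x)} else {}" "Pair x ` ?ch"] inj
    by (auto split: if_splits)
  moreover have "card ?ch \<le> out_degree T x"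
    unfolding out_degree_def out_arcs_T inj[symmetric] using fin by (intro card_mono) auto
  ultimately show "out_degree T x \<le> 3" "out_degree T x \<le> 1 \<longleftrightarrow> is_singleton (label x)"
    using card_children[OF assms] by (auto split: if_splits)
qed

definition \<gamma> :: "'a \<Rightarrow> 'b" where
  "\<gamma> v = inv_into N label {v}"

lemma \<gamma>: "v \<in> V \<Longrightarrow> \<gamma> v \<in> N \<and> label (\<gamma> v) = {v}"
  using singleton_label by (simp add: \<gamma>_def inv_into_into f_inv_into_f)

lemma bij_\<gamma>: "bij_betw \<gamma> V (leaves T)"
proof (rule bij_betw_imageI)
  show "inj_on \<gamma> V" using \<gamma> by (intro inj_onI) (metis singleton_inject)
  show "\<gamma> ` V = leaves T"
  proof
    show "\<gamma> ` V \<subseteq> leaves T" using \<gamma> out_degree_T(2) by (auto simp: leaves_def)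
    show "leaves T \<subseteq> \<gamma> ` V"
    proof
      fix x assume "x \<in> leaves T"
      then have x: "x \<in> N" "is_singleton (label x)" using out_degree_T(2) by (auto simp: leaves_def)
      then obtain v where v: "label x = {v}" by (auto simp: is_singleton_def)
      then have "v \<in> V" using label_subset x by auto
      moreover have "\<gamma> v = x" using \<gamma>[OF \<open>v \<in> V\<close>] v x(1) inj_label by (metis inj_onD)
      ultimately show "x \<in> \<gamma> ` V" by blast
    qed
  qed
qed

lemma rank_decomposition_T: "pverts G = V \<Longrightarrow> rank_decomposition G T \<gamma>"
  using undirected_tree_T out_degree_T(1) bij_\<gamma> by (simp add: rank_decomposition_def)

text \<open>No remaining arc joins a vertex with label inside \<open>label x\<close> to one without,
  and on either side every vertex can climb, to \<open>x\<close> or to the root, without using the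
  deleted edge.\<close>

lemma reachable_delete_edge:
  assumes x: "x \<in> N" "x \<noteq> root" and z: "z \<in> N"
  shows "x \<rightarrow>\<^sup>*\<^bsub>delete_edge T x (parent x)\<^esub> z \<longleftrightarrow> label z \<subseteq> label x"
    and "parent x \<rightarrow>\<^sup>*\<^bsub>delete_edge T x (parent x)\<^esub> z \<longleftrightarrow> \<not> label z \<subseteq> label x"
proof -
  let ?D = "delete_edge T x (parent x)"
  let ?E = "up - {(x, parent x)}"
  have xup: "(x, parent x) \<in> up" using x by (simp add: up_iff)
  have "(parent x, x) \<notin> up" using up_label[OF xup] up_label[of "parent x" x] by blast
  then have arcs: "parcs ?D = ?E \<union> ?E\<inverse>" using xup by (auto simp: delete_edge_def)
  have verts: "pverts ?D = N" by (simp add: delete_edge_def)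
  interpret D: pair_wf_digraph ?D
    by unfold_locales (use arcs verts up_label in fastforce)+
  have reach: "a \<rightarrow>\<^sup>*\<^bsub>?D\<^esub> b \<longleftrightarrow> (a, b) \<in> (?E \<union> ?E\<inverse>)\<^sup>*" if "a \<in> N" for a b
    using D.reachable_conv'[of a b] that verts arcs by simp
  have symE: "sym ((?E \<union> ?E\<inverse>)\<^sup>*)" by (intro sym_rtrancl) (auto simp: sym_def)
  have E_sub: "?E\<^sup>* \<subseteq> (?E \<union> ?E\<inverse>)\<^sup>*" by (intro rtrancl_mono) auto
  \<comment> \<open>By \<open>parent_least\<close>, a vertex strictly below \<open>x\<close> has its
    parent still within \<open>label x\<close>.\<close>
  have arc_side: "label c \<subseteq> label x \<longleftrightarrow> label d \<subseteq> label x" if "(c, d) \<in> ?E" for c d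
  proof
    have cd: "c \<in> N" "d \<in> N" "label c \<subset> label d" "d = parent c" "c \<noteq> root" "c \<noteq> x"
      using that up_label[of c d] by (auto simp: up_iff)
    show "label d \<subseteq> label x" if "label c \<subseteq> label x"
    proof -
      have "label c \<noteq> label x" using cd(1,6) x(1) inj_label by (meson inj_onD)
      then show ?thesis using parent_least[OF cd(1) x(1)] that cd(4) by blast
    qed
    show "label c \<subseteq> label x" if "label d \<subseteq> label x" using that cd(3) by blast
  qed
  have side: "label a \<subseteq> label x \<longleftrightarrow> label b \<subseteq> label x" if "(a, b) \<in> (?E \<union> ?E\<inverse>)\<^sup>*" for a b
    using that by (induction rule: rtrancl_induct) (use arc_side in blast)+
  have below: "(z, x) \<in> ?E\<^sup>*" if "label z \<subseteq> label x" "z \<in> N" for z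
  proof (rule up_reachable[where P = "\<lambda>w. label w \<subseteq> label x"])
    fix w assume w: "w \<in> N" "w \<noteq> x" "label w \<subseteq> label x"
    then have "label w \<subset> label x" using inj_label x(1) by (meson inj_onD psubsetI)
    then have "w \<noteq> root" "label (parent w) \<subseteq> label x"
      using label_root label_subset[OF x(1)] parent_least[OF w(1) x(1)] by auto
    then show "w \<noteq> root \<and> (w, parent w) \<in> ?E \<and> label (parent w) \<subseteq> label x"
      using w by (auto simp: up_iff)
  qed (use that in auto)
  have above: "(z, root) \<in> ?E\<^sup>*" if "\<not> label z \<subseteq> label x" "z \<in> N" for z
  proof (rule up_reachable[where P = "\<lambda>w. \<not> label w \<subseteq> label x"])
    fix w assume w: "w \<in> N" "w \<noteq> root" "\<not> label w \<subseteq> label x"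
    then show "w \<noteq> root \<and> (w, parent w) \<in> ?E \<and> \<not> label (parent w) \<subseteq> label x"
      using label_parent[of w] by (auto simp: up_iff)
  qed (use that in auto)
  have px: "parent x \<in> N" "\<not> label (parent x) \<subseteq> label x"
    using up_label[OF xup] by auto
  show "x \<rightarrow>\<^sup>*\<^bsub>?D\<^esub> z \<longleftrightarrow> label z \<subseteq> label x"
    unfolding reach[OF x(1)] using side[of x z] below[of z] z E_sub symE by (auto dest: symD)
  show "parent x \<rightarrow>\<^sup>*\<^bsub>?D\<^esub> z \<longleftrightarrow> \<not> label z \<subseteq> label x"
  proof
    assume "parent x \<rightarrow>\<^sup>*\<^bsub>?D\<^esub> z"
    then show "\<not> label z \<subseteq> label x" using side[of "parent x" z] px reach by blast
  next
    assume "\<not> label z \<subseteq> label x"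
    then have "(z, root) \<in> (?E \<union> ?E\<inverse>)\<^sup>*" "(parent x, root) \<in> (?E \<union> ?E\<inverse>)\<^sup>*"
      using above px z E_sub by blast+
    then show "parent x \<rightarrow>\<^sup>*\<^bsub>?D\<^esub> z" using reach[OF px(1)] symE by (meson rtrancl_trans symD)
  qed
qed

lemma edge_side_T:
  assumes "x \<in> N" "x \<noteq> root" "pverts G = V"
  shows "edge_side G T \<gamma> x (parent x) = label x" "edge_side G T \<gamma> (parent x) x = V - label x"
  using reachable_delete_edge[OF assms(1,2)] \<gamma> label_subset[OF assms(1)] assms(3)
  by (auto simp: edge_side_def delete_edge_commute[of T "parent x" x])

lemma decomposition_width_T_le:
  assumes "pverts G = V"
    and "\<And>x. x \<in> N \<Longrightarrow> cutrank G (label x) (V - label x) \<le> K"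
    and "\<And>x. x \<in> N \<Longrightarrow> cutrank G (V - label x) (label x) \<le> K"
  shows "decomposition_width G T \<gamma> \<le> K"
\<comment> \<open>The one-vertex tree has no arcs, and the empty supremum is 0.\<close>
proof (cases "parcs T = {}")
  case True
  then show ?thesis unfolding decomposition_width_def by (simp add: Sup_nat_def)
next
  case False
  then show ?thesis
    unfolding decomposition_width_def
  proof (rule cSUP_least)
    fix e assume "e \<in> parcs T"
    then obtain x where x: "x \<in> N" "x \<noteq> root" and e: "e = (x, parent x) \<or> e = (parent x, x)"
      by (auto simp: up_def)
    then show "(case e of (a, b) \<Rightarrow> cutrank G (edge_side G T \<gamma> a b) (edge_side G T \<gamma> b a)) \<le> K"
      using edge_side_T[OF x assms(1)] assms(2,3) by auto
  qed
qed

end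

text \<open>Recursion on the two parts of \<open>S\<close>, whose trees are hung below a new root
  \<open>S\<close>. The sets themselves are the tree vertices, hence the label
  \<open>id\<close>.\<close>

lemma exists_laminar_family:
  assumes "finite S" "S \<noteq> {}" "ok S"
    and split: "\<And>A. A \<subseteq> S \<Longrightarrow> 2 \<le> card A \<Longrightarrow> ok A \<Longrightarrow>
      \<exists>A1 A2. A1 \<union> A2 = A \<and> A1 \<inter> A2 = {} \<and> A1 \<noteq> {} \<and> A2 \<noteq> {} \<and> ok A1 \<and> ok A2"
  shows "\<exists>F par. set_labelled_tree F S par id S \<and> (\<forall>A\<in>F. ok A)"
  using assms
proof (induction "card S" arbitrary: S rule: less_induct)
  case less
  show ?case
  proof (cases "2 \<le> card S")
    case False
    then have "card S = 1" using less.prems(1,2) by (metis One_nat_def Suc_leI card_0_eq le_antisym neq0_conv not_less_eq_eq numeral_2_eq_2)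
    then have "is_singleton S" by (simp add: is_singleton_altdef)
    then have "set_labelled_tree {S} S id id S"
      using less.prems(1,2) by unfold_locales (auto simp: is_singleton_def)
    then show ?thesis using less.prems(3) by blast
  next
    case True
    obtain S1 S2 where S12: "S1 \<union> S2 = S" "S1 \<inter> S2 = {}" "S1 \<noteq> {}" "S2 \<noteq> {}" "ok S1" "ok S2"
      using less.prems(4)[OF subset_refl True less.prems(3)] by blast
    have sub: "S1 \<subset> S" "S2 \<subset> S" using S12 by auto
    have rec: "\<exists>F par. set_labelled_tree F S' par id S' \<and> (\<forall>A\<in>F. ok A)"
      if S': "S' \<subset> S" "S' \<noteq> {}" "ok S'" for S'
    proof (rule less.hyps)
      show "card S' < card S" using less.prems(1) S'(1) by (rule psubset_card_mono)
      show "finite S'" using less.prems(1) S'(1) finite_subset by blast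
      show "\<exists>A1 A2. A1 \<union> A2 = A \<and> A1 \<inter> A2 = {} \<and> A1 \<noteq> {} \<and> A2 \<noteq> {} \<and> ok A1 \<and> ok A2"
        if "A \<subseteq> S'" "2 \<le> card A" "ok A" for A
        using that S'(1) by (intro less.prems(4)) auto
    qed (use S' in auto)
    obtain F1 par1 where t1: "set_labelled_tree F1 S1 par1 id S1" and ok1: "\<forall>A\<in>F1. ok A"
      using rec[OF sub(1) S12(3,5)] by blast
    obtain F2 par2 where t2: "set_labelled_tree F2 S2 par2 id S2" and ok2: "\<forall>A\<in>F2. ok A"
      using rec[OF sub(2) S12(4,6)] by blast
    interpret t1: set_labelled_tree F1 S1 par1 id S1 by (rule t1)
    interpret t2: set_labelled_tree F2 S2 par2 id S2 by (rule t2)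
    define F where "F = insert S (F1 \<union> F2)"
    define par where "par A = (if A = S1 \<or> A = S2 then S else if A \<in> F1 then par1 A else par2 A)" for A
    \<comment> \<open>Members of the two families are nonempty subsets of disjoint sets, so the
      families share no vertex.\<close>
    have F1: "A \<noteq> {} \<and> A \<subseteq> S1 \<and> A \<noteq> S \<and> A \<notin> F2 \<and> \<not> A \<subseteq> S2 \<and> A \<noteq> S2" if "A \<in> F1" for A
      using t1.label_nonempty[OF that] t1.label_subset[OF that] t2.label_subset[of A] S12 by auto
    have F2: "A \<noteq> {} \<and> A \<subseteq> S2 \<and> A \<noteq> S \<and> A \<notin> F1 \<and> \<not> A \<subseteq> S1 \<and> A \<noteq> S1" if "A \<in> F2" for A
      using t2.label_nonempty[OF that] t2.label_subset[OF that] t1.label_subset[of A] S12 by auto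
    have par1: "par A = par1 A" "par1 A \<in> F1" "A \<subset> par1 A" if "A \<in> F1" "A \<noteq> S1" for A
      using that F1[of A] t1.parent_in[of A] t1.label_parent[of A] by (auto simp: par_def)
    have par2: "par A = par2 A" "par2 A \<in> F2" "A \<subset> par2 A" if "A \<in> F2" "A \<noteq> S2" for A
      using that F2[of A] t2.parent_in[of A] t2.label_parent[of A] by (auto simp: par_def)
    have parS: "par S1 = S" "par S2 = S" by (auto simp: par_def)
    have ch1: "{B \<in> F - {S}. par B = A} = {B \<in> F1 - {S1}. par1 B = A}" if A: "A \<in> F1" for A
    proof -
      have "B \<in> F1 - {S1} \<and> par1 B = A" if "B \<in> F - {S}" "par B = A" for B
      proof -
        have ne: "B \<noteq> S1" "B \<noteq> S2" using that(2) parS F1[OF A] by blast+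
        have "B \<notin> F2" using par2(1,2)[of B] ne that(2) F1[OF A] by auto
        then have "B \<in> F1" using that(1) by (simp add: F_def)
        then show ?thesis using par1(1)[of B] ne that(2) by simp
      qed
      moreover have "B \<in> F - {S} \<and> par B = A" if "B \<in> F1 - {S1}" "par1 B = A" for B
        using that par1(1)[of B] F1[of B] by (simp add: F_def)
      ultimately show ?thesis by blast
    qed
    have ch2: "{B \<in> F - {S}. par B = A} = {B \<in> F2 - {S2}. par2 B = A}" if A: "A \<in> F2" for A
    proof -
      have "B \<in> F2 - {S2} \<and> par2 B = A" if "B \<in> F - {S}" "par B = A" for B
      proof -
        have ne: "B \<noteq> S1" "B \<noteq> S2" using that(2) parS F2[OF A] by blast+
        have "B \<notin> F1" using par1(1,2)[of B] ne that(2) F2[OF A] by auto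
        then have "B \<in> F2" using that(1) by (simp add: F_def)
        then show ?thesis using par2(1)[of B] ne that(2) by simp
      qed
      moreover have "B \<in> F - {S} \<and> par B = A" if "B \<in> F2 - {S2}" "par2 B = A" for B
        using that par2(1)[of B] F2[of B] by (simp add: F_def)
      ultimately show ?thesis by blast
    qed
    have chS: "{B \<in> F - {S}. par B = S} = {S1, S2}"
    proof -
      have "B = S1 \<or> B = S2" if "B \<in> F - {S}" "par B = S" for B
      proof (rule ccontr)
        assume ne: "\<not> (B = S1 \<or> B = S2)"
        have "B \<in> F1 \<or> B \<in> F2" using that(1) by (auto simp: F_def)
        then have "S \<in> F1 \<or> S \<in> F2"
        proof
          assume "B \<in> F1"
          then show ?thesis using par1(1,2)[of B] ne that(2) by simp
        next
          assume "B \<in> F2"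
          then show ?thesis using par2(1,2)[of B] ne that(2) by simp
        qed
        then show False using F1[of S] F2[of S] by blast
      qed
      then show ?thesis using parS t1.root_in t2.root_in sub by (auto simp: F_def)
    qed
    have in_S: "A \<subseteq> S" if "A \<in> F" for A using that F1[of A] F2[of A] sub unfolding F_def by blast
    have par_F: "par A \<in> F \<and> A \<subset> par A" if A: "A \<in> F" "A \<noteq> S" for A
    proof -
      consider "A = S1 \<or> A = S2" | "A \<in> F1" "A \<noteq> S1" | "A \<in> F2" "A \<noteq> S2"
        using A unfolding F_def by blast
      then show ?thesis
      proof cases
        case 1
        then show ?thesis using parS sub by (auto simp: F_def)
      next
        case 2
        then show ?thesis using par1[OF 2] by (simp add: F_def)
      next
        case 3
        then show ?thesis using par2[OF 3] by (simp add: F_def)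
      qed
    qed
    have "set_labelled_tree F S par id S"
    proof
      show "finite F" using t1.finite_N t2.finite_N by (simp add: F_def)
      show "S \<in> F" "id S = S" "finite S" "inj_on id F" using less.prems(1) by (simp_all add: F_def)
      fix A B v
      show "id A \<noteq> {}" if "A \<in> F" using that F1 F2 less.prems(2) by (auto simp: F_def)
      show "id A \<subseteq> S" if "A \<in> F" using in_S[OF that] by simp
      show "{v} \<in> id ` F" if "v \<in> S"
        using that t1.singleton_label[of v] t2.singleton_label[of v] S12(1) by (auto simp: F_def)
      show "par A \<in> F" if "A \<in> F" "A \<noteq> S" using par_F[OF that] by simp
      show "id A \<subset> id (par A)" if "A \<in> F" "A \<noteq> S" using par_F[OF that] by simp
      show "id (par A) \<subseteq> id B" if AB: "A \<in> F" "B \<in> F" "id A \<subset> id B"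
      proof -
        have AB': "A \<subset> B" using AB by simp
        then have "A \<noteq> S" using in_S[OF AB(2)] by blast
        consider "B = S" | "B \<in> F1" | "B \<in> F2" using AB(2) by (auto simp: F_def)
        then show ?thesis
        proof cases
          case 1
          then show ?thesis using par_F[OF AB(1) \<open>A \<noteq> S\<close>] in_S by simp
        next
          case 2
          then have "A \<in> F1" "A \<noteq> S1" using AB(1) AB' F1[of B] F2[of A] \<open>A \<noteq> S\<close> unfolding F_def by blast+
          then show ?thesis using t1.parent_least[of A B] 2 AB' par1(1)[of A] by simp
        next
          case 3
          then have "A \<in> F2" "A \<noteq> S2" using AB(1) AB' F2[of B] F1[of A] \<open>A \<noteq> S\<close> unfolding F_def by blast+
          then show ?thesis using t2.parent_least[of A B] 3 AB' par2(1)[of A] by simp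
        qed
      qed
      show "card {B \<in> F - {S}. par B = A} = (if is_singleton (id A) then 0 else 2)" if "A \<in> F"
      proof -
        have "\<not> is_singleton S" using True by (simp add: is_singleton_altdef)
        moreover have "S1 \<noteq> S2" using S12 by auto
        ultimately have "card {B \<in> F - {S}. par B = S} = (if is_singleton S then 0 else 2)"
          using chS by simp
        moreover have "card {B \<in> F - {S}. par B = A} = (if is_singleton A then 0 else 2)" if "A \<in> F1"
          using ch1[OF that] t1.card_children[OF that] by simp
        moreover have "card {B \<in> F - {S}. par B = A} = (if is_singleton A then 0 else 2)" if "A \<in> F2"
          using ch2[OF that] t2.card_children[OF that] by simp
        moreover have "A = S \<or> A \<in> F1 \<or> A \<in> F2" using that by (simp add: F_def)
        ultimately show ?thesis unfolding id_apply by blast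
      qed
    qed
    moreover have "\<forall>A\<in>F. ok A" using ok1 ok2 less.prems(3) by (auto simp: F_def)
    ultimately show ?thesis by blast
  qed
qed

text \<open>\<open>rankwidth\<close> ranges over trees on natural numbers, so the tree of sets is
  moved along an injection \<open>f\<close>, whose inverse becomes the label.\<close>

lemma set_labelled_tree_nat:
  assumes "set_labelled_tree F S par id S"
  shows "\<exists>(N :: nat set) root parent label. set_labelled_tree N root parent label S \<and> label ` N = F"
proof -
  interpret t: set_labelled_tree F S par id S by (rule assms)
  obtain f :: "'a set \<Rightarrow> nat" where f: "inj_on f F"
    using finite_imp_inj_to_nat_seg[OF t.finite_N] by blast
  define g where "g = inv_into F f"
  have gf: "g (f A) = A" if "A \<in> F" for A using that f by (simp add: g_def)
  have f_eq: "f A = f B \<longleftrightarrow> A = B" if "A \<in> F" "B \<in> F" for A B using that f by (meson inj_onD)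
  have par: "par A \<in> F" "A \<subset> par A" if "A \<in> F" "A \<noteq> S" for A
    using t.parent_in[OF that] t.label_parent[OF that] by auto
  have ch: "card {y \<in> f ` F - {f S}. f (par (g y)) = f A} = card {B \<in> F - {S}. par B = A}" if A: "A \<in> F" for A
  proof -
    have "{y \<in> f ` F - {f S}. f (par (g y)) = f A} = f ` {B \<in> F - {S}. par B = A}"
    proof (intro equalityI subsetI)
      fix y assume "y \<in> {y \<in> f ` F - {f S}. f (par (g y)) = f A}"
      then obtain B where B: "B \<in> F" "y = f B" "B \<noteq> S" "f (par (g y)) = f A" by auto
      then have "par B = A" using gf par f_eq A by simp
      then show "y \<in> f ` {B \<in> F - {S}. par B = A}" using B by blast
    next
      fix y assume "y \<in> f ` {B \<in> F - {S}. par B = A}"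
      then show "y \<in> {y \<in> f ` F - {f S}. f (par (g y)) = f A}"
        using gf f_eq t.root_in by auto
    qed
    moreover have "inj_on f {B \<in> F - {S}. par B = A}" using f by (rule inj_on_subset) auto
    ultimately show ?thesis by (simp add: card_image)
  qed
  have "set_labelled_tree (f ` F) (f S) (\<lambda>y. f (par (g y))) g S"
  proof
    show "finite (f ` F)" "f S \<in> f ` F" "finite S" using t.finite_N t.root_in t.finite_V by auto
    show "g (f S) = S" using gf t.root_in by simp
    show "inj_on g (f ` F)" using gf by (intro inj_onI) auto
    have par_g: "par (g x) \<in> F \<and> g x \<subset> par (g x)" if "x \<in> f ` F" "x \<noteq> f S" for x
    proof -
      obtain A where "A \<in> F" "x = f A" using \<open>x \<in> f ` F\<close> by blast
      moreover from this have "A \<noteq> S" using \<open>x \<noteq> f S\<close> by blast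
      ultimately show ?thesis using gf par by simp
    qed
    fix x y v
    show "g x \<noteq> {}" if "x \<in> f ` F" using that gf t.label_nonempty by auto
    show "g x \<subseteq> S" if "x \<in> f ` F" using that gf t.label_subset by auto
    show "{v} \<in> g ` f ` F" if "v \<in> S" using t.singleton_label[OF that] gf by force
    show "f (par (g x)) \<in> f ` F" if "x \<in> f ` F" "x \<noteq> f S" using par_g[OF that] by simp
    show "g x \<subset> g (f (par (g x)))" if "x \<in> f ` F" "x \<noteq> f S" using par_g[OF that] gf by simp
    show "g (f (par (g x))) \<subseteq> g y" if xy: "x \<in> f ` F" "y \<in> f ` F" "g x \<subset> g y"
    proof -
      obtain A B where AB: "A \<in> F" "B \<in> F" "x = f A" "y = f B" using xy(1,2) by blast
      then have "A \<subset> B" using xy(3) gf by simp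
      moreover from this have "A \<noteq> S" using t.label_subset[OF AB(2)] by auto
      ultimately show ?thesis using AB gf par t.parent_least[of A B] by simp
    qed
    show "card {y \<in> f ` F - {f S}. f (par (g y)) = x} = (if is_singleton (g x) then 0 else 2)" if "x \<in> f ` F"
      using that ch gf t.card_children by auto
  qed
  moreover have "g ` f ` F = F" using gf by (simp add: image_image)
  ultimately show ?thesis by blast
qed

section \<open>Cut-rank of induced subgraphs\<close>

definition graph_rank :: "'a pair_pre_digraph \<Rightarrow> 'a set \<Rightarrow> 'a set \<Rightarrow> nat" where
  "graph_rank G X Y = F2_rank (X \<inter> pverts G) (Y \<inter> pverts G) (Adj G)"

lemma graph_rank_eq_cutrank:
  "X \<subseteq> pverts G \<Longrightarrow> Y \<subseteq> pverts G \<Longrightarrow> graph_rank G X Y = cutrank G X Y"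
  by (simp add: graph_rank_def cutrank_def Int_absorb2)

lemma rank_connectivity_graph_rank:
  assumes "pair_graph G"
  shows "rank_connectivity (graph_rank G) (pverts G)"
proof -
  interpret pair_graph G by (rule assms)
  have "Adj G x y = Adj G y x" for x y
    using arcs_symmetric by (auto simp: Adj_def)
  then have "rank_bifunction (graph_rank G)"
    unfolding graph_rank_def[abs_def] by (intro rank_bifunction_F2_rank finite_verts)
  then show ?thesis
    by (simp add: rank_connectivity_def rank_connectivity_axioms_def finite_verts)
qed

text \<open>\<open>pverts G\<close> has cut-rank 0, so splitting can start there and goes on down to
  singletons; the labels of the resulting tree are its cuts.\<close>

lemma rankwidth_le:
  assumes "pair_graph G" "pverts G \<noteq> {}"
    and split: "\<And>S. S \<subseteq> pverts G \<Longrightarrow> 2 \<le> card S \<Longrightarrow> rank_connectivity.cut (graph_rank G) (pverts G) S \<le> K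
      \<Longrightarrow> rank_connectivity.splits (graph_rank G) (pverts G) K S"
  shows "rankwidth G \<le> K"
proof -
  let ?V = "pverts G"
  interpret rank_connectivity "graph_rank G" ?V by (rule rank_connectivity_graph_rank) fact
  have "cut ?V \<le> K" using rank_empty rank_sym[of ?V "{}"] by (simp add: cut_def)
  then obtain F par where tree: "set_labelled_tree F ?V par id ?V" and F: "\<forall>A\<in>F. cut A \<le> K"
    using exists_laminar_family[of ?V "\<lambda>A. cut A \<le> K"] finite_V \<open>?V \<noteq> {}\<close> split
    unfolding splits_def by blast
  obtain N :: "nat set" and root parent label where N: "set_labelled_tree N root parent label ?V" "label ` N = F"
    using set_labelled_tree_nat[OF tree] by blast
  interpret t: set_labelled_tree N root parent label ?V by (rule N(1))
  have "cutrank G (label x) (?V - label x) \<le> K" "cutrank G (?V - label x) (label x) \<le> K" if "x \<in> N" for x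
  proof -
    have "label x \<in> F" using that N(2) by blast
    then have "cut (label x) \<le> K" using F by blast
    then show "cutrank G (label x) (?V - label x) \<le> K" "cutrank G (?V - label x) (label x) \<le> K"
      using t.label_subset[OF that] rank_sym[of "label x" "?V - label x"]
      by (simp_all add: cut_def graph_rank_eq_cutrank)
  qed
  then have "decomposition_width G t.T t.\<gamma> \<le> K" by (intro t.decomposition_width_T_le) auto
  moreover have "rankwidth G \<le> decomposition_width G t.T t.\<gamma>"
  proof -
    let ?D = "{(T :: nat pair_pre_digraph, \<gamma>). rank_decomposition G T \<gamma>}"
    have "(t.T, t.\<gamma>) \<in> ?D" using t.rank_decomposition_T by simp
    then have "(INF (T, \<gamma>) \<in> ?D. decomposition_width G T \<gamma>) \<le> (case (t.T, t.\<gamma>) of (T, \<gamma>) \<Rightarrow> decomposition_width G T \<gamma>)"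
      by (intro cINF_lower) auto
    then show ?thesis using \<open>?V \<noteq> {}\<close> by (simp add: rankwidth_def)
  qed
  ultimately show ?thesis by simp
qed

section \<open>Induced subgraphs and their balanced cuts\<close>

definition induced :: "'a pair_pre_digraph \<Rightarrow> 'a set \<Rightarrow> 'a pair_pre_digraph" where
  "induced G U = \<lparr>pverts = U, parcs = parcs G \<inter> U \<times> U\<rparr>"

lemma induced_subgraph_induced:
  assumes "pair_graph G" "U \<subseteq> pverts G"
  shows "induced_subgraph (with_proj (induced G U)) (with_proj G)"
proof -
  interpret pair_graph G by (rule assms)
  have "wf_digraph (with_proj (induced G U))"
    by unfold_locales (auto simp: induced_def)
  then show ?thesis
    using assms(2) wf_digraph_axioms
    by (auto simp: induced_subgraph_def subgraph_def compatible_def induced_def)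
qed

text \<open>Halving works from two vertices on; for one vertex the rounded-up half exceeds two
  thirds.\<close>

lemma balanced_partitions_nonempty:
  assumes "2 \<le> card (pverts G)"
  shows "balanced_partitions G \<noteq> {}"
proof -
  let ?U = "pverts G"
  have fin: "finite ?U" using assms by (metis card.infinite not_numeral_le_zero)
  obtain X where X: "X \<subseteq> ?U" "card X = card ?U div 2"
    using obtain_subset_with_card_n[of "card ?U div 2" ?U] by auto
  have "card (?U - X) = card ?U - card ?U div 2"
    using X fin by (simp add: card_Diff_subset finite_subset)
  moreover have "3 * (card ?U div 2) \<le> 2 * card ?U" "3 * (card ?U - card ?U div 2) \<le> 2 * card ?U"
    using assms by linarith+
  then have "3 * real (card ?U div 2) \<le> 2 * real (card ?U)" "3 * real (card ?U - card ?U div 2) \<le> 2 * real (card ?U)"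
    by linarith+
  ultimately have "(X, ?U - X) \<in> balanced_partitions G"
    using X by (auto simp: balanced_partitions_def)
  then show ?thesis by blast
qed

text \<open>A nonempty set of naturals attains its infimum, and within \<open>U\<close> the
  adjacency matrices of \<open>G\<close> and of the induced subgraph agree.\<close>

lemma balanced_cut_of_induced:
  assumes "U \<subseteq> pverts G" "2 \<le> card U" "min_bal_cutrank (induced G U) < r"
  shows "\<exists>X Y. X \<union> Y = U \<and> X \<inter> Y = {} \<and> 3 * card X \<le> 2 * card U \<and> 3 * card Y \<le> 2 * card U \<and> graph_rank G X Y < r"
proof -
  let ?H = "induced G U"
  let ?f = "\<lambda>(X, Y). cutrank ?H X Y"
  have verts: "pverts ?H = U" by (simp add: induced_def)
  have ne: "balanced_partitions ?H \<noteq> {}" using assms(2) verts by (intro balanced_partitions_nonempty) simp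
  then have "Inf (?f ` balanced_partitions ?H) \<in> ?f ` balanced_partitions ?H" by (intro Inf_nat_def1) simp
  moreover have "Inf (?f ` balanced_partitions ?H) < r"
    using assms(3) ne by (simp add: min_bal_cutrank_def)
  ultimately obtain X Y where XY: "(X, Y) \<in> balanced_partitions ?H" "cutrank ?H X Y < r" by auto
  have part: "X \<union> Y = U" "X \<inter> Y = {}" "3 * card X \<le> 2 * card U" "3 * card Y \<le> 2 * card U"
    using XY(1) verts by (auto simp: balanced_partitions_def)
  have "cutrank ?H X Y = cutrank G X Y"
    unfolding cutrank_def by (rule F2_rank_cong) (use part(1) in \<open>auto simp: Adj_def induced_def\<close>)
  also have "\<dots> = graph_rank G X Y"
    by (rule graph_rank_eq_cutrank[symmetric]) (use part(1) assms(1) in auto)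
  finally show ?thesis using part XY(2) by auto
qed

theorem theorem1:
  fixes G :: "'a pair_pre_digraph" and r :: nat
  assumes "r \<ge> 1"
    and "pair_graph G"
    and "rankwidth G \<ge> 72 * r"
  shows "\<exists>H :: 'a pair_pre_digraph. induced_subgraph (with_proj H) (with_proj G) \<and> min_bal_cutrank H \<ge> r"
proof (rule ccontr)
  assume "\<not> ?thesis"
  then have small: "min_bal_cutrank (induced G U) < r" if "U \<subseteq> pverts G" for U
    using induced_subgraph_induced[OF assms(2) that] not_less by blast
  interpret rank_connectivity "graph_rank G" "pverts G"
    by (rule rank_connectivity_graph_rank) fact
  \<comment> \<open>The empty graph has rankwidth 0 by convention.\<close>
  have "pverts G \<noteq> {}" using assms(1,3) by (auto simp: rankwidth_def)
  moreover have "\<not> rankwidth G \<le> 72 * r - 1" using assms(1,3) by linarith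
  \<comment> \<open>If all sets of cut-rank at most \<open>72 * r - 1\<close> with at least two
    elements could be split, \<open>rankwidth_le\<close> would contradict the hypothesis.\<close>
  ultimately obtain S where "S \<subseteq> pverts G" "2 \<le> card S" "cut S \<le> 72 * r - 1" "\<not> splits (72 * r - 1) S"
    using rankwidth_le[OF assms(2), of "72 * r - 1"] by blast
  then obtain W where "well_linked W" "card W = 72 * r - 1"
    using well_linked_if_not_splits[of S "72 * r - 1"] assms(1) by fastforce
  then show False
    using not_well_linked[OF balanced_cut_of_induced[OF _ _ small] assms(1)] by blast
qed

end
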